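(* Let $f(n)=n^2+2bn+c$ with integers $b,c$ such that $\delta:=b^2-c$ is non-zero and square-free, and $\delta\not\equiv 1\pmod 4$. Assume $f(n)\ge 0$ for all integers $n\ge 1$. Let $\chi(n)=\left(\frac{4\delta}{n}\right)$ be the Kronecker symbol and $$M_\delta=\begin{cases}\frac{4}{\pi^2}\delta^{1/2}\log(4\delta)+1.8934\,\delta^{1/2}+1.668, & \delta>0,\\[2pt] \frac{1}{\pi}|\delta|^{1/2}\log(4|\delta|)+1.6408\,|\delta|^{1/2}+1.0285, & \delta<0.\end{cases}$$ Then for every integer $N\ge1$ with $f(N)\ge f(1)$, setting $X:=\sqrt{f(N)}$, we have \begin{align*} \sum_{n=1}^N \tau(n^2+2bn+c)\le{}& \frac{2}{\zeta(2)}L(1,\chi)\, N\log X + \left(2.332\,L(1,\chi)+\frac{4M_\delta}{\zeta(2)}\right)N+\frac{2M_\delta}{\zeta(2)} X\\ &+4\sqrt{3}\left(1-\frac{1}{\zeta(2)}\right)M_\delta\frac{N}{\sqrt{X}}+2\sqrt{3}\left(1-\frac{1}{\zeta(2)}\right)M_\delta\sqrt{X}. \end{align*}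
   Context: $\tau(m)$ denotes the number of positive divisors of the integer $m$; $\zeta$ is the Riemann zeta function; $L(1,\chi)=\sum_{n\ge1}\chi(n)/n$. *)

theory Defs
  imports "HOL-Analysis.Analysis" "HOL-Number_Theory.Number_Theory"
    "HOL-Computational_Algebra.Squarefree"
begin

definition divisor_count :: "int \<Rightarrow> nat" where
  "divisor_count m = card {d :: int. d > 0 \<and> d dvd m}"

text \<open>
  The Kronecker symbol at a prime is the Legendre symbol at odd primes; at 2 it has the
  conventional value, where \<^term>\<open>a mod 8\<close> is the least nonnegative residue, also for negative \<open>a\<close>.
\<close>

definition kronecker_prime :: "int \<Rightarrow> int \<Rightarrow> int" where
  "kronecker_prime a p =
     (if p = 2 then (if even a then 0 else if a mod 8 \<in> {1, 7} then 1 else -1)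
      else Legendre a p)"

definition kronecker :: "int \<Rightarrow> int \<Rightarrow> int" where
  "kronecker a n =
     (if n = 0 then (if \<bar>a\<bar> = 1 then 1 else 0)
      else (if n < 0 \<and> a < 0 then -1 else 1) *
           (\<Prod>p\<in>prime_factors n. kronecker_prime a p ^ multiplicity p n))"

text \<open>
  The Dirichlet series of the Riemann zeta function, on its half-line of convergence \<^prop>\<open>s > 1\<close>.
\<close>

definition riemann_zeta :: "real \<Rightarrow> real" where
  "riemann_zeta s = (\<Sum>n. 1 / real (Suc n) powr s)"

text \<open>
  The value \<open>L(1, chi)\<close> as a series in the natural order of summation: for a nonprincipal character
  it converges only conditionally.
\<close>

definition L_one :: "(int \<Rightarrow> int) \<Rightarrow> real" where
  "L_one chi = (\<Sum>n. real_of_int (chi (int (Suc n))) / real (Suc n))"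

definition M_const :: "int \<Rightarrow> real" where
  "M_const \<delta> =
     (let d = real_of_int \<bar>\<delta>\<bar> in
      if \<delta> > 0 then 4 / pi\<^sup>2 * sqrt d * ln (4 * d) + 1.8934 * sqrt d + 1.668
      else 1 / pi * sqrt d * ln (4 * d) + 1.6408 * sqrt d + 1.0285)"

end

theory Submission
  imports Defs
begin

text \<open>
  Every \<open>m > 0\<close> has at most twice as many divisors as it has divisors up to \<open>sqrt m\<close>, so the sum is at
  most \<open>2 (N B + A)\<close> with \<open>A\<close> and \<open>B\<close> the sums of \<open>\<rho>(d)\<close> and \<open>\<rho>(d) / d\<close> over \<open>d \<le> X\<close>, where \<open>\<rho>(d)\<close>
  counts the square roots of \<open>\<delta>\<close> modulo \<open>d\<close>. The function \<open>\<rho>\<close> is at most the Dirichlet convolution of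
  \<open>\<chi>\<close> with the indicator of the squarefree numbers. The constant \<open>M\<close> has the size of a Polya-Vinogradov
  bound, but the trivial bound \<open>D = \<bar>\<delta>\<bar>\<close> for the character sums is enough: in the sums over the squarefree
  \<open>m\<close> the character sum of length \<open>X / m\<close> reaches the size \<open>D\<close> only for \<open>m \<le> X / D\<close>. This
  costs only \<open>1 + ln D\<close> in \<open>A\<close> and \<open>O(sqrt D)\<close> in \<open>B\<close>, both of which \<open>M\<close> absorbs.
  The trivial bound holds because, by quadratic reciprocity, \<open>\<chi>(n + 2 D) = - \<chi>(n)\<close>.
\<close>

section \<open>Quadratic reciprocity for the Kronecker symbol\<close>

text \<open>The tight spot is the coefficient of \<open>L\<close>. In \<open>B\<close> the target
  leaves room for \<open>1.166 L\<close> (half of 2.332) beside the logarithmic term, whereas the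
  elementary estimate for the sum of \<open>1 / m\<close> over squarefree \<open>m\<close> has a
  constant of about 2.24. The surplus, between 1 and 1.1 times \<open>L\<close>, is therefore
  charged to \<open>M\<close> as well, which requires the explicit bound
  \<open>L \<le> 3 / 2 + ln D / 2\<close>. The sign of \<open>L\<close> matters too, because an
  upper bound for the squarefree sum is multiplied by \<open>L\<close>; it follows from the
  nonnegativity of the root counts. The condition on \<open>\<delta>\<close> modulo 4 acts in three
  places: it makes \<open>\<chi>\<close> antiperiodic for odd \<open>\<delta>\<close>, it excludes
  square roots of \<open>\<delta>\<close> modulo 4, and it keeps \<open>f\<close> free of
  zeros.\<close>

lemma kronecker_mult_pos:
  fixes m n :: int
  assumes "m > 0" "n > 0"
  shows "kronecker a (m * n) = kronecker a m * kronecker a n"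
proof -
  have eq: "kronecker a k = (\<Prod>p\<in>#prime_factorization k. kronecker_prime a p)" if "k > 0" for k
    using that by (auto simp: kronecker_def image_prod_mset_multiplicity
        count_prime_factorization_prime intro!: prod.cong dest: in_prime_factors_imp_prime)
  show ?thesis using assms by (simp add: eq prime_factorization_mult)
qed

lemma kronecker_prime_pos:
  assumes "prime (p::int)"
  shows "kronecker a p = kronecker_prime a p"
  using assms prime_gt_0_int[OF assms]
  by (simp add: kronecker_def prime_factorization_prime prime_imp_prime_elem multiplicity_self)

text \<open>By Euler's criterion both sides are congruent modulo \<open>p\<close>; as elements of
  \<open>{-1, 0, 1}\<close> they differ by at most 2, which is less than \<open>p\<close>.\<close>

lemma Legendre_mult:
  assumes "prime p" "2 < p"
  shows "Legendre (a * b) (int p) = Legendre a (int p) * Legendre b (int p)"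
proof -
  have "[Legendre (a * b) p = a ^ ((p - 1) div 2) * b ^ ((p - 1) div 2)] (mod p)"
    using euler_criterion[OF assms, of "a * b"] by (simp add: power_mult_distrib)
  moreover have "[Legendre a p * Legendre b p = a ^ ((p - 1) div 2) * b ^ ((p - 1) div 2)] (mod p)"
    by (intro cong_mult euler_criterion assms)
  ultimately have "[Legendre (a * b) p = Legendre a p * Legendre b p] (mod p)"
    using cong_sym cong_trans by blast
  then have d: "int p dvd Legendre (a * b) p - Legendre a p * Legendre b p"
    by (simp add: cong_iff_dvd_diff)
  have "\<bar>Legendre (a * b) p - Legendre a p * Legendre b p\<bar> < int p"
    using assms(2) by (auto simp: Legendre_def)
  with d show ?thesis
    using zdvd_not_zless[of "\<bar>Legendre (a * b) p - Legendre a p * Legendre b p\<bar>" "int p"]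
    by auto
qed

lemma Legendre_cong:
  assumes "[a = b] (mod p)"
  shows "Legendre a p = Legendre b p"
proof -
  have "[x = a] (mod p) \<longleftrightarrow> [x = b] (mod p)" "[a = x] (mod p) \<longleftrightarrow> [b = x] (mod p)" for x
    using assms by (simp_all add: cong_def)
  then show ?thesis by (simp add: Legendre_def QuadRes_def)
qed

lemma Legendre_one:
  assumes "p > 1" shows "Legendre 1 p = 1"
proof -
  have "QuadRes p 1" unfolding QuadRes_def by (rule exI[of _ 1]) auto
  moreover have "\<not> [1 = 0] (mod p)" using assms by (auto simp: cong_0_iff)
  ultimately show ?thesis by (simp add: Legendre_def)
qed

section \<open>The supplementary laws: characters modulo 4 and 8\<close>

definition chi4 :: "int \<Rightarrow> int" where
  "chi4 n = (if n mod 4 = 1 then 1 else - 1)"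

definition chi8 :: "int \<Rightarrow> int" where
  "chi8 n = (if n mod 8 \<in> {1, 7} then 1 else - 1)"

lemma chi4_mult:
  assumes "odd m" "odd n" shows "chi4 (m * n) = chi4 m * chi4 n"
proof -
  have "m mod 4 = 1 \<or> m mod 4 = 3" "n mod 4 = 1 \<or> n mod 4 = 3" using assms by presburger+
  moreover have "(m * n) mod 4 = ((m mod 4) * (n mod 4)) mod 4" by (simp add: mod_mult_eq)
  ultimately show ?thesis by (auto simp: chi4_def)
qed

lemma chi8_mult:
  assumes "odd m" "odd n" shows "chi8 (m * n) = chi8 m * chi8 n"
proof -
  have "m mod 8 = 1 \<or> m mod 8 = 3 \<or> m mod 8 = 5 \<or> m mod 8 = 7"
    "n mod 8 = 1 \<or> n mod 8 = 3 \<or> n mod 8 = 5 \<or> n mod 8 = 7" using assms by presburger+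
  moreover have "(m * n) mod 8 = ((m mod 8) * (n mod 8)) mod 8" by (simp add: mod_mult_eq)
  ultimately show ?thesis unfolding chi8_def by (elim disjE) simp_all
qed

lemma chi4_prime:
  assumes "prime p" "2 < p"
  shows "Legendre (-1) (int p) = chi4 (int p)"
proof -
  have o: "odd p" using assms prime_odd_nat by blast
  then have "(- 1) ^ ((p - 1) div 2) = chi4 (int p)" 
  proof -
    have "p mod 4 = 1 \<or> p mod 4 = 3" using o by presburger
    then show ?thesis
    proof
      assume h: "p mod 4 = 1"
      then have "even ((p - 1) div 2)" by presburger
      moreover have "int p mod 4 = 1" using h by presburger
      ultimately show ?thesis by (simp add: chi4_def)
    next
      assume h: "p mod 4 = 3"
      then have "odd ((p - 1) div 2)" by presburger
      moreover have "int p mod 4 \<noteq> 1" using h by presburger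
      ultimately show ?thesis by (simp add: chi4_def)
    qed
  qed
  with euler_criterion[OF assms, of "-1"] have "[Legendre (-1) p = chi4 p] (mod p)" by simp
  then have d: "int p dvd Legendre (-1) p - chi4 p" by (simp add: cong_iff_dvd_diff)
  have "\<bar>Legendre (-1) p - chi4 p\<bar> < int p"
    using assms(2) by (auto simp: Legendre_def chi4_def)
  with d show ?thesis
    using zdvd_not_zless[of "\<bar>Legendre (-1) p - chi4 p\<bar>" "int p"] by auto
qed

text \<open>Gauss's lemma. Doubling a number up to \<open>h = (p - 1) / 2\<close> stays below
  \<open>p\<close>, so the residues above \<open>h\<close> are the \<open>2 * x\<close> with
  \<open>x > h div 2\<close>; the parity of their number \<open>h - h div 2\<close> depends only on
  \<open>p mod 8\<close>.\<close>

lemma chi8_prime: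
  assumes "prime p" "2 < p"
  shows "Legendre 2 (int p) = chi8 (int p)"
proof -
  have o: "odd p" using assms prime_odd_nat by blast
  have "\<not> [2 = 0] (mod int p)" using assms(2) by (auto simp: cong_0_iff dest: zdvd_imp_le)
  then interpret G: GAUSS p 2 using assms by unfold_locales auto
  define h where "h = (int p - 1) div 2"
  have ph: "int p = 2 * h + 1" using o unfolding h_def by presburger
  have "G.E = (\<lambda>x. 2 * x) ` {h div 2 + 1..h}"
  proof -
    have "G.C = (\<lambda>x. 2 * x) ` {0<..h}"
      unfolding G.C_def G.B_def G.A_def h_def[symmetric] image_image
      by (rule image_cong) (use ph in auto)
    then show ?thesis unfolding G.E_def h_def[symmetric] by auto
  qed
  then have "card G.E = nat (h - h div 2)"
    by (simp add: card_image inj_on_def)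
  moreover have "(- 1) ^ nat (h - h div 2) = chi8 (int p)"
  proof -
    have h0: "h \<ge> 0" using ph assms(2) by simp
    have "odd (int p)" using o by simp
    then have "int p mod 8 = 1 \<or> int p mod 8 = 7 \<or> int p mod 8 = 3 \<or> int p mod 8 = 5" by presburger
    then consider "int p mod 8 = 1 \<or> int p mod 8 = 7" | "int p mod 8 = 3 \<or> int p mod 8 = 5" by blast
    then show ?thesis
    proof cases
      case 1
      then have "even (h - h div 2)" using ph by presburger
      then have "even (nat (h - h div 2))" using h0 by (simp add: even_nat_iff)
      then show ?thesis using 1 by (auto simp: chi8_def)
    next
      case 2
      then have "odd (h - h div 2)" using ph by presburger
      then have "odd (nat (h - h div 2))" using h0 by (simp add: even_nat_iff)
      then show ?thesis using 2 by (auto simp: chi8_def)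
    qed
  qed
  ultimately show ?thesis using G.gauss_lemma by simp
qed

text \<open>The sign is written so that for fixed \<open>q\<close> the right-hand side is a
  character in \<open>p\<close>, ready to be extended to composite arguments. For
  \<open>p = q\<close> both symbols vanish.\<close>

lemma Legendre_swap:
  assumes "prime p" "2 < p" "prime q" "2 < q"
  shows "Legendre (int q) (int p) = Legendre (int p) (int q) * (if int q mod 4 = 3 then chi4 (int p) else 1)"
proof (cases "p = q")
  case True
  then show ?thesis by (simp add: Legendre_def cong_0_iff)
next
  case False
  have op: "odd p" "odd q" using assms prime_odd_nat by blast+
  have QR: "Legendre p q * Legendre q p = (-1::int) ^ ((p - 1) div 2 * ((q - 1) div 2))"
    using Quadratic_Reciprocity[of p q] assms False by simp
  have s: "(-1::int) ^ ((p - 1) div 2 * ((q - 1) div 2)) = (if int q mod 4 = 3 then chi4 (int p) else 1)"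
  proof (cases "int q mod 4 = 3")
    case True
    then have "odd ((q - 1) div 2)" by presburger
    moreover have "even ((p - 1) div 2) \<longleftrightarrow> int p mod 4 = 1" using op by presburger
    ultimately show ?thesis using True by (auto simp: chi4_def minus_one_power_iff)
  next
    case False
    then have "even ((q - 1) div 2)" using op by presburger
    then show ?thesis using False by simp
  qed
  have "Legendre p q = 1 \<or> Legendre p q = -1 \<or> Legendre p q = 0" by (simp add: Legendre_def)
  moreover have "Legendre p q \<noteq> 0" using QR by auto
  ultimately show ?thesis using QR s by auto
qed

section \<open>Reciprocity for squarefree numerators and odd arguments\<close>

definition odd_primes_of :: "int \<Rightarrow> int set" where
  "odd_primes_of \<delta> = prime_factors \<delta> - {2}"

text \<open>The right-hand side of quadratic reciprocity for \<open>(\<delta> / n)\<close> with squarefree \<open>\<delta>\<close>: unlike the Kronecker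
  symbol it is visibly periodic in \<open>n\<close>. It is meant for odd \<open>n\<close> only; \<open>chi4\<close> and \<open>chi8\<close> have the
  junk value \<open>-1\<close> at even arguments.\<close>

definition reciprocal_char :: "int \<Rightarrow> int \<Rightarrow> int" where
  "reciprocal_char \<delta> n = (if \<delta> < 0 then chi4 n else 1) * (if even \<delta> then chi8 n else 1) *
     (\<Prod>q\<in>odd_primes_of \<delta>. Legendre n q * (if q mod 4 = 3 then chi4 n else 1))"

lemma odd_primes_ofD:
  assumes "q \<in> odd_primes_of \<delta>"
  shows "prime q" "2 < q" "q dvd \<delta>" "odd q" "prime (nat q)" "2 < nat q" "int (nat q) = q"
proof -
  show p: "prime q" and "q dvd \<delta>" using assms by (auto simp: odd_primes_of_def)
  have "q \<noteq> 2" using assms by (auto simp: odd_primes_of_def)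
  then show q2: "2 < q" using prime_ge_2_int[OF p] by simp
  then show "odd q" using p prime_odd_int by blast
  show "prime (nat q)" "2 < nat q" "int (nat q) = q" using p q2 by auto
qed

lemma squarefree_int_decomp:
  fixes \<delta> :: int
  assumes "squarefree \<delta>"
  shows "\<delta> = (if \<delta> < 0 then -1 else 1) * (if even \<delta> then 2 else 1) * \<Prod>(odd_primes_of \<delta>)"
proof -
  have n0: "\<delta> \<noteq> 0" using assms by auto
  have "\<bar>\<delta>\<bar> = (\<Prod>p\<in>prime_factors \<delta>. p ^ multiplicity p \<delta>)"
    using prod_prime_factors[OF n0] by simp
  also have "\<dots> = \<Prod>(prime_factors \<delta>)"
    using assms n0 by (intro prod.cong) (auto simp: squarefree_factorial_semiring')
  also have "\<dots> = (if even \<delta> then 2 else 1) * \<Prod>(odd_primes_of \<delta>)"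
  proof (cases "even \<delta>")
    case True
    then have "2 \<in> prime_factors \<delta>" using n0 by (auto simp: in_prime_factors_iff)
    then show ?thesis using True by (simp add: odd_primes_of_def prod.remove)
  next
    case False
    then have "2 \<notin> prime_factors \<delta>" by (auto simp: in_prime_factors_iff)
    then show ?thesis using False by (simp add: odd_primes_of_def)
  qed
  finally show ?thesis by (auto simp: abs_if split: if_splits)
qed

lemma reciprocal_char_mult:
  assumes "odd m" "odd n"
  shows "reciprocal_char \<delta> (m * n) = reciprocal_char \<delta> m * reciprocal_char \<delta> n"
proof -
  have "Legendre (m * n) q * (if q mod 4 = 3 then chi4 (m * n) else 1)
      = (Legendre m q * (if q mod 4 = 3 then chi4 m else 1)) *
        (Legendre n q * (if q mod 4 = 3 then chi4 n else 1))" if "q \<in> odd_primes_of \<delta>" for q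
    using Legendre_mult[of "nat q" m n] odd_primes_ofD[OF that] by (simp add: chi4_mult assms)
  then have "(\<Prod>q\<in>odd_primes_of \<delta>. Legendre (m * n) q * (if q mod 4 = 3 then chi4 (m * n) else 1))
    = (\<Prod>q\<in>odd_primes_of \<delta>. Legendre m q * (if q mod 4 = 3 then chi4 m else 1)) *
      (\<Prod>q\<in>odd_primes_of \<delta>. Legendre n q * (if q mod 4 = 3 then chi4 n else 1))"
    unfolding prod.distrib[symmetric] by (intro prod.cong) auto
  then show ?thesis unfolding reciprocal_char_def by (simp add: chi4_mult chi8_mult assms)
qed

lemma Legendre_prod:
  assumes "prime p" "2 < p" "finite A"
  shows "Legendre (\<Prod>A) (int p) = (\<Prod>q\<in>A. Legendre q (int p))"
  using assms(3) by induction (use assms in \<open>simp_all add: Legendre_one Legendre_mult\<close>)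

text \<open>The sign of \<open>\<delta>\<close> and a possible factor 2 are handled by the
  supplementary laws, each odd prime factor by \<open>Legendre_swap\<close>.\<close>

lemma reciprocal_char_prime:
  assumes "squarefree \<delta>" "prime p" "2 < p"
  shows "Legendre \<delta> (int p) = reciprocal_char \<delta> (int p)"
proof -
  let ?s = "if \<delta> < 0 then -1 else 1 :: int" and ?e = "if even \<delta> then 2 else 1 :: int"
  have "Legendre \<delta> (int p) = Legendre (?s * ?e * \<Prod>(odd_primes_of \<delta>)) (int p)"
    using squarefree_int_decomp[OF assms(1)] by presburger
  also have "\<dots> = Legendre ?s p * Legendre ?e p * (\<Prod>q\<in>odd_primes_of \<delta>. Legendre q (int p))"
    using assms by (simp add: Legendre_mult Legendre_prod odd_primes_of_def del: mult_minus1 mult_minus_left)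
  also have "Legendre ?s p = (if \<delta> < 0 then chi4 p else 1)"
    using assms by (simp add: chi4_prime Legendre_one)
  also have "Legendre ?e p = (if even \<delta> then chi8 p else 1)"
    using assms by (simp add: chi8_prime Legendre_one)
  also have "(\<Prod>q\<in>odd_primes_of \<delta>. Legendre q (int p))
      = (\<Prod>q\<in>odd_primes_of \<delta>. Legendre (int p) q * (if q mod 4 = 3 then chi4 (int p) else 1))"
  proof (rule prod.cong[OF refl])
    fix q assume "q \<in> odd_primes_of \<delta>"
    from odd_primes_ofD[OF this] Legendre_swap[of p "nat q"] assms
    show "Legendre q (int p) = Legendre (int p) q * (if q mod 4 = 3 then chi4 (int p) else 1)" by simp
  qed
  finally show ?thesis by (simp add: reciprocal_char_def)
qed

section \<open>The Kronecker symbol of \<open>4 * \<delta>\<close> and its antiperiod\<close>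

lemma kronecker_prime_4:
  assumes "prime p" "2 < p"
  shows "kronecker (4 * \<delta>) (int p) = Legendre \<delta> (int p)"
proof -
  have "\<not> [4 = 0] (mod int p)"
  proof
    assume "[4 = 0] (mod int p)"
    then have "int p dvd 2 * 2" by (simp add: cong_0_iff)
    then have "int p dvd 2" using assms prime_dvd_mult_iff[of "int p" 2 2] by simp
    then show False using assms(2) zdvd_imp_le by fastforce
  qed
  moreover have "QuadRes p 4" unfolding QuadRes_def by (rule exI[of _ 2]) auto
  ultimately have "Legendre 4 p = 1" by (simp add: Legendre_def)
  then show ?thesis
    using assms by (simp add: kronecker_prime_pos kronecker_prime_def Legendre_mult)
qed

lemma kronecker_even:
  assumes "n > 0" "even n" shows "kronecker (4 * \<delta>) n = 0"
proof -
  from assms obtain m where m: "n = 2 * m" by auto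
  then have "kronecker (4 * \<delta>) n = kronecker (4 * \<delta>) 2 * kronecker (4 * \<delta>) m"
    using assms kronecker_mult_pos[of 2 m] by simp
  also have "kronecker (4 * \<delta>) 2 = 0" by (simp add: kronecker_prime_pos kronecker_prime_def)
  finally show ?thesis by simp
qed

lemma kronecker_one: "kronecker a 1 = 1"
  by (simp add: kronecker_def)

lemma kronecker_odd:
  assumes "squarefree \<delta>"
  shows "n > 0 \<Longrightarrow> odd n \<Longrightarrow> kronecker (4 * \<delta>) n = reciprocal_char \<delta> n"
proof (induction n rule: prime_divisors_induct)
  case (unit x)
  then have "x = 1" by auto
  moreover have "Legendre 1 q = 1" if "q \<in> odd_primes_of \<delta>" for q
    using odd_primes_ofD[OF that] by (simp add: Legendre_one)
  ultimately show ?case by (simp add: kronecker_one reciprocal_char_def chi4_def chi8_def cong: if_cong)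
next
  case (factor p x)
  have p0: "p > 0" using factor prime_gt_0_int by blast
  have x0: "x > 0" using factor.prems p0 zero_less_mult_pos by blast
  have o: "odd p" "odd x" using factor.prems by auto
  have "p \<noteq> 2" using o by auto
  then have "2 < p" using prime_ge_2_int[OF factor.hyps] by simp
  then have p: "prime (nat p)" "2 < nat p" "int (nat p) = p" using factor.hyps by auto
  have "kronecker (4 * \<delta>) p = reciprocal_char \<delta> p"
    using kronecker_prime_4[OF p(1,2)] reciprocal_char_prime[OF assms p(1,2)] p(3) by simp
  then show ?case using factor.IH x0 o p0 by (simp add: kronecker_mult_pos reciprocal_char_mult)
qed simp

lemma chi4_prod:
  assumes "finite A" "\<And>q. q \<in> A \<Longrightarrow> odd q"
  shows "odd (\<Prod>A) \<and> chi4 (\<Prod>A) = (\<Prod>q\<in>A. chi4 q)"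
  using assms by induction (auto simp: chi4_mult chi4_def[of 1])

text \<open>The shift is a multiple of every \<open>q\<close>, so only \<open>chi4\<close> and
  \<open>chi8\<close> can change. For even \<open>\<delta>\<close> squarefreeness makes the shift 4
  modulo 8, which fixes \<open>chi4\<close> and flips the single \<open>chi8\<close>. For odd
  \<open>\<delta>\<close> the shift is 2 modulo 4 and flips every \<open>chi4\<close>; their number,
  one for a negative sign and one for each prime congruent to 3 modulo 4, is odd precisely because
  \<open>\<delta>\<close> is congruent to 3 modulo 4.\<close>

lemma reciprocal_char_antiperiodic:
  assumes "squarefree \<delta>" "\<not> [\<delta> = 1] (mod 4)" "odd n"
  shows "reciprocal_char \<delta> (n + 2 * \<bar>\<delta>\<bar>) = - reciprocal_char \<delta> n"
proof -
  let ?n = "n + 2 * \<bar>\<delta>\<bar>"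
  have fin: "finite (odd_primes_of \<delta>)" by (simp add: odd_primes_of_def)
  have Leg: "Legendre ?n q = Legendre n q" if "q \<in> odd_primes_of \<delta>" for q
  proof (rule Legendre_cong)
    show "[?n = n] (mod q)" using odd_primes_ofD[OF that] by (simp add: cong_iff_dvd_diff)
  qed
  show ?thesis
  proof (cases "even \<delta>")
    case True
    have "\<not> 4 dvd \<delta>" using squarefreeD[OF assms(1), of 2] by (auto simp: power2_eq_square)
    moreover have "even \<bar>\<delta>\<bar>" "4 dvd \<bar>\<delta>\<bar> \<longleftrightarrow> 4 dvd \<delta>" using True by simp_all
    ultimately have "\<bar>\<delta>\<bar> mod 4 = 2" by presburger
    then obtain k where "\<bar>\<delta>\<bar> = 4 * k + 2" by (metis mult_div_mod_eq)
    then have n: "?n = (n + 4) + 8 * k" by simp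
    have "?n mod 4 = n mod 4" unfolding n by presburger
    then have c4: "chi4 ?n = chi4 n" by (simp add: chi4_def)
    have n8: "?n mod 8 = (n + 4) mod 8" unfolding n by presburger
    have "chi8 (n + 4) = - chi8 n"
    proof -
      have "n mod 8 = 1 \<or> n mod 8 = 3 \<or> n mod 8 = 5 \<or> n mod 8 = 7" using assms(3) by presburger
      moreover have "(n + 4) mod 8 = (n mod 8 + 4) mod 8" by presburger
      ultimately show ?thesis unfolding chi8_def by (elim disjE) simp_all
    qed
    with n8 have c8: "chi8 ?n = - chi8 n" by (simp add: chi8_def)
    have "(\<Prod>q\<in>odd_primes_of \<delta>. Legendre ?n q * (if q mod 4 = 3 then chi4 ?n else 1))
      = (\<Prod>q\<in>odd_primes_of \<delta>. Legendre n q * (if q mod 4 = 3 then chi4 n else 1))"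
      by (intro prod.cong) (simp_all add: Leg c4)
    then show ?thesis unfolding reciprocal_char_def c4 c8 using True by simp
  next
    case False
    then have d3: "\<delta> mod 4 = 3" using assms(2) unfolding cong_def by presburger
    have "chi4 (n + 2 * a) = - chi4 n" if "odd a" for a
      using that assms(3) unfolding chi4_def by presburger
    then have c: "chi4 ?n = - chi4 n" using False by simp
    let ?S = "if \<delta> < 0 then -1 else 1 :: int"
    let ?T = "\<Prod>q\<in>odd_primes_of \<delta>. if q mod 4 = 3 then - 1 else 1 :: int"
    have "chi4 \<delta> = chi4 (?S * \<Prod>(odd_primes_of \<delta>))"
      using squarefree_int_decomp[OF assms(1)] False by simp
    also have "\<dots> = chi4 ?S * (\<Prod>q\<in>odd_primes_of \<delta>. chi4 q)"
      using chi4_prod[OF fin] odd_primes_ofD(4) by (simp add: chi4_mult del: mult_minus1 mult_minus_left)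
    also have "chi4 ?S = ?S" by (simp add: chi4_def)
    also have "(\<Prod>q\<in>odd_primes_of \<delta>. chi4 q) = ?T"
    proof (rule prod.cong[OF refl])
      fix q assume "q \<in> odd_primes_of \<delta>"
      then have "odd q" by (rule odd_primes_ofD)
      then show "chi4 q = (if q mod 4 = 3 then - 1 else 1)" unfolding chi4_def by presburger
    qed
    finally have ST: "?S * ?T = - 1" using d3 by (simp add: chi4_def)
    have "(\<Prod>q\<in>odd_primes_of \<delta>. Legendre ?n q * (if q mod 4 = 3 then chi4 ?n else 1))
      = (\<Prod>q\<in>odd_primes_of \<delta>. (Legendre n q * (if q mod 4 = 3 then chi4 n else 1)) *
          (if q mod 4 = 3 then - 1 else 1))"
      by (intro prod.cong) (simp_all add: Leg c)
    also have "\<dots> = (\<Prod>q\<in>odd_primes_of \<delta>. Legendre n q * (if q mod 4 = 3 then chi4 n else 1)) * ?T"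
      by (rule prod.distrib)
    finally have P: "(\<Prod>q\<in>odd_primes_of \<delta>. Legendre ?n q * (if q mod 4 = 3 then chi4 ?n else 1))
      = (\<Prod>q\<in>odd_primes_of \<delta>. Legendre n q * (if q mod 4 = 3 then chi4 n else 1)) * ?T" .
    have "reciprocal_char \<delta> ?n = (?S * (if \<delta> < 0 then chi4 n else 1)) *
       ((\<Prod>q\<in>odd_primes_of \<delta>. Legendre n q * (if q mod 4 = 3 then chi4 n else 1)) * ?T)"
      unfolding reciprocal_char_def P unfolding c using False by simp
    also have "\<dots> = (?S * ?T) * reciprocal_char \<delta> n"
      using False by (simp add: reciprocal_char_def)
    finally show ?thesis by (simp add: ST)
  qed
qed

lemma kronecker_antiperiodic:
  assumes "squarefree \<delta>" "\<not> [\<delta> = 1] (mod 4)" "n \<ge> 0"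
  shows "kronecker (4 * \<delta>) (n + 2 * \<bar>\<delta>\<bar>) = - kronecker (4 * \<delta>) n"
proof -
  have d0: "\<delta> \<noteq> 0" using assms(1) by auto
  consider "odd n" | "even n" "n > 0" | "n = 0" using assms(3) by fastforce
  then show ?thesis
  proof cases
    case 1
    then show ?thesis using assms d0
      by (auto simp: kronecker_odd reciprocal_char_antiperiodic order_le_less)
  next
    case 2
    then show ?thesis by (simp add: kronecker_even)
  next
    case 3
    then show ?thesis using d0 by (simp add: kronecker_even kronecker_def[of _ 0])
  qed
qed

lemma abs_kronecker_le: "n > 0 \<Longrightarrow> \<bar>kronecker (4 * \<delta>) n\<bar> \<le> 1"
proof (induction n rule: prime_divisors_induct)
  case (unit x)
  then show ?case using kronecker_one by auto
next
  case (factor p x)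
  have p0: "p > 0" using factor prime_gt_0_int by blast
  have x0: "x > 0" using factor.prems p0 zero_less_mult_pos by blast
  have "\<bar>kronecker (4 * \<delta>) p\<bar> \<le> 1"
    using factor.hyps by (auto simp: kronecker_prime_pos kronecker_prime_def Legendre_def)
  then show ?case using factor.IH x0 p0 mult_le_one[of "\<bar>kronecker (4 * \<delta>) p\<bar>" "\<bar>kronecker (4 * \<delta>) x\<bar>"]
    by (simp add: kronecker_mult_pos abs_mult)
qed simp

section \<open>Antiperiodic real characters and their L-series at 1\<close>

lemma sum_lessThan_add:
  fixes f :: "nat \<Rightarrow> 'a::comm_monoid_add"
  shows "(\<Sum>i<m + n. f i) = (\<Sum>i<m. f i) + (\<Sum>i<n. f (m + i))"
  by (induction n) (simp_all add: add.assoc)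

text \<open>The midpoint rule underestimates the integral of the convex function
  \<open>1 / x\<close>: \<open>2 / (2 * n + 1)\<close> is at most \<open>ln (n + 1) - ln n\<close>,
  and this telescopes.\<close>

lemma sum_inverse_odd_le_ln:
  fixes a n :: nat
  assumes "1 \<le> a" "a \<le> n"
  shows "(\<Sum>i\<in>{a..<n}. 1 / real (2 * i + 1)) \<le> ln (real n / real a) / 2"
  using assms(2)
proof (induction n rule: dec_induct)
  case (step n)
  have "2 / (2 * real n + 1) \<le> ln (real n + 1) - ln (real n)"
    using ln_inverse_approx_ge[of "real n" "real n + 1"] step assms by (simp add: add.commute)
  then show ?case using step assms by (simp add: ln_div add.commute)
qed (use assms in simp)

lemma sum_inverse_le_ln:
  fixes a n :: nat
  assumes "1 \<le> a" "a \<le> n"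
  shows "(\<Sum>m\<in>{a<..n}. 1 / real m) \<le> ln (real n / real a)"
  using assms(2)
proof (induction n rule: dec_induct)
  case (step n)
  have "ln (real n / real (Suc n)) \<le> real n / real (Suc n) - 1"
    using step assms by (intro ln_le_minus_one) auto
  also have "\<dots> = - (1 / real (Suc n))" by (simp add: field_simps)
  finally have "1 / real (Suc n) \<le> ln (real (Suc n)) - ln (real n)"
    using step assms by (simp add: ln_div)
  moreover have "{a<..Suc n} = insert (Suc n) {a<..n}" using step by auto
  ultimately show ?case using step assms by (simp add: ln_div)
qed (use assms in simp)

lemma sum_inverse_le_one_plus_ln:
  assumes "n \<ge> 1"
  shows "(\<Sum>m\<in>{1..n}. 1 / real m) \<le> 1 + ln (real n)"
proof -
  have "{1..n} = insert 1 {1<..n}" using assms by auto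
  then show ?thesis using sum_inverse_le_ln[of 1 n] assms by simp
qed

text \<open>The antiperiod \<open>2 * D\<close> says more than the period \<open>4 * D\<close>:
  together with the vanishing at even arguments it brings the trivial bound for interval sums down
  to \<open>D\<close>.\<close>

locale antiperiodic_character =
  fixes chi :: "nat \<Rightarrow> real" and D :: nat
  assumes D_pos: "1 \<le> D"
    and chi_mult: "\<And>m n. 0 < m \<Longrightarrow> 0 < n \<Longrightarrow> chi (m * n) = chi m * chi n"
    and chi_one: "chi 1 = 1"
    and chi_even: "\<And>n. even n \<Longrightarrow> chi n = 0"
    and chi_values: "\<And>n. chi n \<in> {-1, 0, 1}"
    and chi_antiperiodic: "\<And>n. chi (n + 2 * D) = - chi n"
begin

lemma abs_chi_le: "\<bar>chi n\<bar> \<le> of_bool (odd n)"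
  using chi_values[of n] chi_even[of n] by auto

lemma count_odd: "(\<Sum>j<2 * n. of_bool (odd (a + j)) :: real) = real n"
  by (induction n) auto

lemma interval_sum_short:
  assumes "n \<le> 2 * D"
  shows "\<bar>\<Sum>j<n. chi (a + j)\<bar> \<le> real D"
proof -
  have "\<bar>\<Sum>j<n. chi (a + j)\<bar> \<le> (\<Sum>j<n. of_bool (odd (a + j)))"
    by (rule order_trans[OF sum_abs sum_mono]) (rule abs_chi_le)
  also have "\<dots> \<le> (\<Sum>j<2 * D. of_bool (odd (a + j)) :: real)"
    using assms by (intro sum_mono2) auto
  finally show ?thesis by (simp only: count_odd)
qed

text \<open>The last \<open>j\<close> terms are the negatives of the first \<open>j\<close> and
  cancel them, so a long interval becomes a short one.\<close>

lemma interval_sum_reflect: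
  assumes "j \<le> 2 * D"
  shows "(\<Sum>i<2 * D + j. chi (a + i)) = (\<Sum>i<2 * D - j. chi (a + j + i))"
proof -
  have "(\<Sum>i<2 * D + j. chi (a + i)) = (\<Sum>i<2 * D. chi (a + i)) + (\<Sum>i<j. chi (a + (2 * D + i)))"
    by (rule sum_lessThan_add)
  also have "(\<Sum>i<j. chi (a + (2 * D + i))) = - (\<Sum>i<j. chi (a + i))"
    unfolding sum_negf[symmetric]
    by (intro sum.cong refl) (metis add.assoc add.commute chi_antiperiodic)
  also have "(\<Sum>i<2 * D. chi (a + i)) = (\<Sum>i<j + (2 * D - j). chi (a + i))"
    using assms by simp
  also have "\<dots> = (\<Sum>i<j. chi (a + i)) + (\<Sum>i<2 * D - j. chi (a + (j + i)))"
    by (rule sum_lessThan_add)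
  finally show ?thesis by (simp add: add.assoc)
qed

text \<open>Up to length \<open>2 * D\<close> the odd terms are counted, up to \<open>4 * D\<close>
  the interval is reflected into a short one, and beyond that a full period is removed.\<close>

lemma interval_sum_le: "\<bar>\<Sum>j<n. chi (a + j)\<bar> \<le> real D"
proof (induction n arbitrary: a rule: less_induct)
  case (less n)
  consider "n \<le> 2 * D" | j where "n = 2 * D + j" "j \<le> 2 * D" | j where "n = 4 * D + j" "j < n"
  proof (cases "n < 4 * D")
    case True
    then have "n \<le> 2 * D \<or> n = 2 * D + (n - 2 * D) \<and> n - 2 * D \<le> 2 * D" by linarith
    then show ?thesis using that by blast
  next
    case False
    then have "n = 4 * D + (n - 4 * D)" "n - 4 * D < n" using D_pos by linarith+
    then show ?thesis using that(3) by blast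
  qed
  then show ?case
  proof cases
    case 1
    then show ?thesis by (rule interval_sum_short)
  next
    case 2
    then show ?thesis using interval_sum_short[of "2 * D - j" "a + j"] by (simp add: interval_sum_reflect)
  next
    case 3
    have "(\<Sum>i<n. chi (a + i)) = (\<Sum>i<2 * D + 2 * D. chi (a + i)) + (\<Sum>i<j. chi (a + (2 * D + 2 * D + i)))"
      using sum_lessThan_add[of "\<lambda>i. chi (a + i)" "2 * D + 2 * D" j] 3 by simp
    \<comment> \<open>Reflection with \<open>j = 2 * D\<close> leaves the empty interval.\<close>
    also have "(\<Sum>i<2 * D + 2 * D. chi (a + i)) = 0" by (subst interval_sum_reflect) auto
    also have "(\<Sum>i<j. chi (a + (2 * D + 2 * D + i))) = (\<Sum>i<j. chi (a + i))"
      by (intro sum.cong refl) (metis add.assoc add.commute chi_antiperiodic minus_minus)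
    finally show ?thesis using less 3 by simp
  qed
qed

lemma interval_sum_le': "\<bar>\<Sum>l\<in>{k<..n}. chi l\<bar> \<le> real D"
proof -
  have "(\<Sum>l\<in>{k<..n}. chi l) = (\<Sum>j<n - k. chi (Suc k + j))"
    by (rule sum.reindex_bij_witness[of _ "\<lambda>j. Suc k + j" "\<lambda>l. l - Suc k"]) auto
  then show ?thesis using interval_sum_le by presburger
qed

text \<open>Partial summation with the boundary term over \<open>n + 1\<close> instead of
  \<open>n\<close>: together with the telescoping weights its share adds up to exactly
  \<open>1 / (k + 1)\<close>.\<close>

lemma abel_interval_sum:
  assumes "k \<le> n"
  shows "(\<Sum>l\<in>{k<..n}. chi l / real l) = (\<Sum>l\<in>{k<..n}. chi l) / (real n + 1)
    + (\<Sum>m\<in>{k<..n}. (\<Sum>l\<in>{k<..m}. chi l) * (1 / real m - 1 / (real m + 1)))"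
  using assms
proof (induction n rule: dec_induct)
  case (step n)
  have i: "{k<..Suc n} = insert (Suc n) {k<..n}" using step by auto
  define T where "T = (\<Sum>l\<in>{k<..n}. chi l)"
  have "T / (real n + 1) + chi (Suc n) / real (Suc n)
      = (T + chi (Suc n)) / (real (Suc n) + 1) + (T + chi (Suc n)) * (1 / real (Suc n) - 1 / (real (Suc n) + 1))"
  proof -
    have "real n + 1 > 0" by simp
    then show ?thesis unfolding of_nat_Suc by (simp add: divide_simps) (simp add: algebra_simps)
  qed
  then show ?case unfolding i using step by (simp add: i T_def add.commute)
qed simp

lemma interval_log_sum_le: "\<bar>\<Sum>l\<in>{k<..n}. chi l / real l\<bar> \<le> real D / (real k + 1)"
proof (cases "k \<le> n")
  case True
  have tele: "(\<Sum>m\<in>{k<..n}. 1 / real m - 1 / (real m + 1)) = 1 / (real k + 1) - 1 / (real n + 1)"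
    using True
  proof (induction n rule: dec_induct)
    case (step n)
    have "{k<..Suc n} = insert (Suc n) {k<..n}" using step by auto
    then show ?case using step by (simp add: add.commute)
  qed simp
  have "\<bar>\<Sum>m\<in>{k<..n}. (\<Sum>l\<in>{k<..m}. chi l) * (1 / real m - 1 / (real m + 1))\<bar>
      \<le> (\<Sum>m\<in>{k<..n}. real D * (1 / real m - 1 / (real m + 1)))"
  proof (rule order_trans[OF sum_abs sum_mono])
    fix m assume "m \<in> {k<..n}"
    then have "0 \<le> 1 / real m - 1 / (real m + 1)" by (simp add: field_simps)
    then show "\<bar>(\<Sum>l\<in>{k<..m}. chi l) * (1 / real m - 1 / (real m + 1))\<bar> \<le> real D * (1 / real m - 1 / (real m + 1))"
      using interval_sum_le'[of k m] by (simp add: abs_mult mult_right_mono)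
  qed
  also have "\<dots> = real D / (real k + 1) - real D / (real n + 1)"
    unfolding sum_distrib_left[symmetric] tele by (simp add: right_diff_distrib)
  finally have 1: "\<bar>\<Sum>m\<in>{k<..n}. (\<Sum>l\<in>{k<..m}. chi l) * (1 / real m - 1 / (real m + 1))\<bar>
      \<le> real D / (real k + 1) - real D / (real n + 1)" .
  have 2: "\<bar>(\<Sum>l\<in>{k<..n}. chi l) / (real n + 1)\<bar> \<le> real D / (real n + 1)"
    using interval_sum_le'[of k n] by (simp add: divide_right_mono abs_divide)
  show ?thesis unfolding abel_interval_sum[OF True] using 1 2 by linarith
qed simp

section \<open>Tails and size of the L-series at 1\<close>

definition L where "L = (\<Sum>n. chi (Suc n) / real (Suc n))"

definition partial_L where "partial_L k = (\<Sum>l\<in>{1..k}. chi l / real l)"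

lemma partial_L_diff:
  assumes "k \<le> n"
  shows "partial_L n - partial_L k = (\<Sum>l\<in>{k<..n}. chi l / real l)"
proof -
  have "{1..n} = {1..k} \<union> {k<..n}" using assms by auto
  then show ?thesis unfolding partial_L_def by (metis (no_types, lifting) add_diff_cancel_left' finite_atLeastAtMost finite_greaterThanAtMost ivl_disj_int_two(8) sum.union_disjoint)
qed

lemma partial_L_eq: "partial_L n = (\<Sum>i<n. chi (Suc i) / real (Suc i))"
  unfolding partial_L_def by (rule sum.reindex_bij_witness[of _ Suc "\<lambda>l. l - 1"]) auto

lemma partial_L_tendsto: "partial_L \<longlonglongrightarrow> L"
proof -
  have "summable (\<lambda>n. chi (Suc n) / real (Suc n))"
  proof (rule summable_Cauchy')
    show "eventually (\<lambda>m. \<forall>n\<ge>m. norm (\<Sum>i\<in>{m..<n}. chi (Suc i) / real (Suc i)) \<le> real D / (real m + 1)) sequentially"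
    proof (intro always_eventually allI impI)
      fix m n :: nat assume "m \<le> n"
      have "(\<Sum>i\<in>{m..<n}. chi (Suc i) / real (Suc i)) = (\<Sum>l\<in>{m<..n}. chi l / real l)"
        by (rule sum.reindex_bij_witness[of _ "\<lambda>l. l - 1" Suc]) auto
      then show "norm (\<Sum>i\<in>{m..<n}. chi (Suc i) / real (Suc i)) \<le> real D / (real m + 1)"
        using interval_log_sum_le[of m n] by simp
    qed
    show "(\<lambda>m. real D / (real m + 1)) \<longlonglongrightarrow> 0"
      using LIMSEQ_Suc[OF lim_const_over_n[of "real D"]] by (simp add: add.commute)
  qed
  then show ?thesis unfolding L_def partial_L_eq by (rule summable_LIMSEQ)
qed

lemma L_tail_le: "\<bar>L - partial_L k\<bar> \<le> real D / (real k + 1)"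
proof (rule tendsto_upperbound)
  show "(\<lambda>n. \<bar>partial_L n - partial_L k\<bar>) \<longlonglongrightarrow> \<bar>L - partial_L k\<bar>"
    by (intro tendsto_intros partial_L_tendsto)
  show "eventually (\<lambda>n. \<bar>partial_L n - partial_L k\<bar> \<le> real D / (real k + 1)) sequentially"
    using eventually_ge_at_top[of k] by eventually_elim (simp add: partial_L_diff interval_log_sum_le)
qed simp

lemma partial_L_diff_le:
  assumes "k \<le> 2 * n"
  shows "\<bar>partial_L (2 * n) - partial_L k\<bar> \<le> (\<Sum>i\<in>{(k + 1) div 2..<n}. 1 / real (2 * i + 1))"
proof -
  have "\<bar>partial_L (2 * n) - partial_L k\<bar> \<le> (\<Sum>l\<in>{k<..2 * n}. of_bool (odd l) / real l)"
    unfolding partial_L_diff[OF assms]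
  proof (rule order_trans[OF sum_abs sum_mono])
    show "\<bar>chi l / real l\<bar> \<le> of_bool (odd l) / real l" for l
      unfolding abs_divide using divide_right_mono[OF abs_chi_le, of "real l" l] by simp
  qed
  also have "\<dots> = (\<Sum>l\<in>{l\<in>{k<..2 * n}. odd l}. 1 / real l)"
    by (rule sum.mono_neutral_cong_right) auto
  \<comment> \<open>With \<open>l = 2 * i + 1\<close>, the least \<open>i\<close> satisfying
    \<open>k < l\<close> is \<open>(k + 1) div 2\<close>.\<close>
  also have "\<dots> = (\<Sum>i\<in>{(k + 1) div 2..<n}. 1 / real (2 * i + 1))"
    by (rule sum.reindex_bij_witness[of _ "\<lambda>i. 2 * i + 1" "\<lambda>l. l div 2"]) (auto elim!: oddE)
  finally show ?thesis .
qed

text \<open>The tail beyond \<open>2 D\<close> is at most \<open>1 / 2\<close>; below \<open>2 D\<close> the terms with odd index give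
  \<open>ln (3 D / y) / 2\<close>. The minimum of this and \<open>D / y\<close> is interpolated by the square root, which is easy to
  sum over \<open>y = n / m\<close>.\<close>

lemma L_tail_le_sqrt:
  assumes "1 \<le> k" "real k \<le> y" "y < real k + 1"
  shows "\<bar>L - partial_L k\<bar> \<le> 1051 / 1000 * sqrt (real D / y)"
proof (cases "real D \<le> y")
  case True
  have "\<bar>L - partial_L k\<bar> \<le> real D / y"
    using L_tail_le[of k] frac_le[of "real D" "real D" y "real k + 1"] assms by simp
  also have "\<dots> \<le> sqrt (real D / y)"
  proof (intro real_le_rsqrt)
    have "0 \<le> real D / y" "real D / y \<le> 1" using True assms by simp_all
    then show "(real D / y)\<^sup>2 \<le> real D / y" by (simp only: power2_eq_square mult_left_le)
  qed
  also have "\<dots> \<le> 1051 / 1000 * sqrt (real D / y)" using assms by simp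
  finally show ?thesis .
next
  case False
  define a where "a = (k + 1) div 2"
  define t where "t = real D / y"
  have kD: "k < D" using False assms by linarith
  \<comment> \<open>The factor 3 is attained at \<open>k = 2\<close>, where
    \<open>a = 1\<close>.\<close>
  have a: "1 \<le> a" "a \<le> D" "k + 1 \<le> 3 * a" using kD assms by (auto simp: a_def)
  have t1: "t > 1" using False assms by (simp add: t_def)
  have t3: "real D / real a \<le> 3 * t"
  proof -
    have "y \<le> 3 * real a" using a assms by linarith
    then show ?thesis using a assms unfolding t_def by (simp add: field_simps mult_left_mono)
  qed
  have "\<bar>partial_L (2 * D) - partial_L k\<bar> \<le> ln (real D / real a) / 2"
    using partial_L_diff_le[of k D] sum_inverse_odd_le_ln[OF a(1,2)] kD by (simp add: a_def)
  also have "\<dots> \<le> ln (3 * t) / 2"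
    using t3 a D_pos by (simp add: ln_mono)
  also have "\<dots> = ln 3 / 2 + ln (sqrt t)" using t1 by (simp add: ln_mult ln_sqrt)
  also have "\<dots> \<le> 551 / 1000 + (sqrt t - 1)"
  proof -
    have "ln (3::real) \<le> 551 / 500"
    proof -
      \<comment> \<open>The trapezoidal rule on \<open>[8, 9]\<close> compares
        \<open>3\<^sup>2\<close> with \<open>2\<^sup>3\<close> and so bounds \<open>ln 3\<close>
        through the known bound for \<open>ln 2\<close>.\<close>
      have "ln (9::real) - ln 8 \<le> (1 / 8 + 1 / 9) / 2" using ln_inverse_approx_le[of 8 1] by simp
      moreover have "ln (9::real) = 2 * ln 3" "ln (8::real) = 3 * ln 2"
        using ln_realpow[of "3::real" 2] ln_realpow[of "2::real" 3] by simp_all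
      moreover have "c \<le> 551 / 500"
        if "a - b \<le> (1 / 8 + 1 / 9) / 2" "a = 2 * c" "b = 3 * d" "d \<le> 25 / 36" for a b c d :: real
        using that by simp
      ultimately show ?thesis using ln2_le_25_over_36 by blast
    qed
    moreover have "ln (sqrt t) \<le> sqrt t - 1" using t1 by (intro ln_le_minus_one) simp
    ultimately show ?thesis by simp
  qed
  \<comment> \<open>Adding the tail \<open>1 / 2\<close> leaves \<open>sqrt t + 51 / 1000\<close>,
    and \<open>t > 1\<close> turns the constant into a multiple of \<open>sqrt t\<close>. This is
    the origin of \<open>1051 / 1000\<close>.\<close>
  finally have 1: "\<bar>partial_L (2 * D) - partial_L k\<bar> \<le> sqrt t - 449 / 1000" by simp
  have "\<bar>L - partial_L (2 * D)\<bar> \<le> real D / (real (2 * D) + 1)" by (rule L_tail_le)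
  also have "\<dots> \<le> 1 / 2" by (simp add: field_simps)
  finally have "\<bar>L - partial_L k\<bar> \<le> sqrt t + 51 / 1000" using 1 by linarith
  also have "\<dots> \<le> 1051 / 1000 * sqrt t" using t1 by simp
  finally show ?thesis by (simp add: t_def)
qed

text \<open>Lets a surplus multiple of \<open>L\<close> be paid for by \<open>M\<close>: the odd
  indices below \<open>2 * D\<close> give \<open>1 + ln D / 2\<close>, the tail at most
  \<open>1 / 2\<close>.\<close>

lemma L_upper: "L \<le> 1.5 + ln (real D) / 2"
proof -
  have "partial_L (2 * D) \<le> (\<Sum>i\<in>{0..<D}. 1 / real (2 * i + 1))"
    using partial_L_diff_le[of 0 D] by (simp add: partial_L_def)
  also have "\<dots> = 1 + (\<Sum>i\<in>{1..<D}. 1 / real (2 * i + 1))"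
    using D_pos by (subst sum.atLeast_Suc_lessThan) auto
  also have "\<dots> \<le> 1 + ln (real D) / 2"
    using sum_inverse_odd_le_ln[of 1 D] D_pos by simp
  finally have "partial_L (2 * D) \<le> 1 + ln (real D) / 2" .
  moreover have "\<bar>L - partial_L (2 * D)\<bar> \<le> real D / (real (2 * D) + 1)" by (rule L_tail_le)
  moreover have "real D / (real (2 * D) + 1) \<le> 1 / 2" by (simp add: field_simps)
  ultimately show ?thesis by linarith
qed

end

section \<open>Reciprocals of squarefree numbers\<close>

lemma square_part_square_mult:
  fixes k m :: nat
  assumes "k > 0" "squarefree m"
  shows "square_part (k\<^sup>2 * m) = k"
proof -
  have m0: "m > 0" using assms by (cases "m = 0") auto
  let ?s = "square_part (k\<^sup>2 * m)"
  have "k dvd ?s" by (simp add: dvd_square_part_iff)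
  then obtain t where t: "?s = k * t" by blast
  have "?s\<^sup>2 dvd k\<^sup>2 * m" by simp
  then have "t\<^sup>2 dvd m" using assms by (simp add: t power_mult_distrib)
  then have "t dvd 1" by (rule squarefreeD[OF assms(2)])
  then show ?thesis using t by simp
qed

definition squarefree_harm :: "nat \<Rightarrow> real" where
  "squarefree_harm n = (\<Sum>m\<in>{m\<in>{1..n}. squarefree m}. 1 / real m)"

text \<open>Every \<open>j \<ge> 1\<close> is \<open>k\<^sup>2 * m\<close> with squarefree
  \<open>m\<close> in exactly one way. Summing over all \<open>k \<le> n\<close> is harmless, as the
  terms with \<open>k\<^sup>2 > n\<close> vanish.\<close>

lemma harm_squarefree_decomp:
  "(\<Sum>j\<in>{1..n}. 1 / real j) = (\<Sum>k\<in>{1..n}. squarefree_harm (n div k\<^sup>2) / (real k)\<^sup>2)"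
proof -
  let ?T = "\<lambda>k. {m\<in>{1..n div k\<^sup>2}. squarefree m}"
  have "(\<Sum>k\<in>{1..n}. squarefree_harm (n div k\<^sup>2) / (real k)\<^sup>2)
      = (\<Sum>k\<in>{1..n}. \<Sum>m\<in>?T k. 1 / (real m * (real k)\<^sup>2))"
    by (simp add: squarefree_harm_def sum_divide_distrib)
  also have "\<dots> = (\<Sum>(k, m)\<in>Sigma {1..n} ?T. 1 / (real m * (real k)\<^sup>2))"
    by (rule sum.Sigma) auto
  also have "\<dots> = (\<Sum>j\<in>{1..n}. 1 / real j)"
  proof (rule sum.reindex_bij_witness[of _ "\<lambda>j. (square_part j, squarefree_part j)" "\<lambda>(k, m). k\<^sup>2 * m"])
    fix x assume x: "x \<in> Sigma {1..n} ?T"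
    obtain k m where km: "x = (k, m)" by force
    have h: "0 < k" "0 < m" "m \<le> n div k\<^sup>2" "squarefree m" using x km by auto
    have sp: "square_part (k\<^sup>2 * m) = k" using square_part_square_mult h by simp
    have "k\<^sup>2 * m = squarefree_part (k\<^sup>2 * m) * k\<^sup>2"
      using squarefree_decompose[of "k\<^sup>2 * m"] sp by simp
    then have "squarefree_part (k\<^sup>2 * m) = m" using h by (simp add: mult.commute)
    with sp show "(square_part (case x of (k, m) \<Rightarrow> k\<^sup>2 * m), squarefree_part (case x of (k, m) \<Rightarrow> k\<^sup>2 * m)) = x"
      by (simp add: km)
    have "k\<^sup>2 * m \<le> n" using h by (simp add: less_eq_div_iff_mult_less_eq mult.commute)
    moreover have "1 \<le> k\<^sup>2 * m" using h by simp
    ultimately show "(case x of (k, m) \<Rightarrow> k\<^sup>2 * m) \<in> {1..n}" by (simp add: km)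
    show "1 / real (case x of (k, m) \<Rightarrow> k\<^sup>2 * m) = (case x of (k, m) \<Rightarrow> 1 / (real m * (real k)\<^sup>2))"
      by (simp add: km mult.commute)
  next
    fix j assume j: "j \<in> {1..n}"
    have dec: "squarefree_part j * (square_part j)\<^sup>2 = j" using squarefree_decompose[of j] by simp
    then show "(case (square_part j, squarefree_part j) of (k, m) \<Rightarrow> k\<^sup>2 * m) = j"
      by (simp add: mult.commute)
    have p: "0 < square_part j" "0 < squarefree_part j" using j by (auto intro!: Nat.gr0I)
    have "squarefree_part j * (square_part j)\<^sup>2 \<le> n" using dec j by simp
    then have "squarefree_part j \<le> n div (square_part j)\<^sup>2"
      using p by (simp add: less_eq_div_iff_mult_less_eq)
    moreover have "square_part j \<le> n"
    proof -
      have "square_part j \<le> (square_part j)\<^sup>2" using p by (simp add: power2_eq_square)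
      also have "\<dots> \<le> squarefree_part j * (square_part j)\<^sup>2" using p by simp
      finally show ?thesis using dec j by simp
    qed
    ultimately show "(square_part j, squarefree_part j) \<in> Sigma {1..n} ?T" using p by auto
  qed
  finally show ?thesis by simp
qed

lemma squarefree_harm_nonneg: "0 \<le> squarefree_harm n"
  unfolding squarefree_harm_def by (intro sum_nonneg) simp

lemma squarefree_harm_0: "squarefree_harm 0 = 0"
  by (simp add: squarefree_harm_def)

lemma squarefree_harm_mono: "m \<le> n \<Longrightarrow> squarefree_harm m \<le> squarefree_harm n"
  unfolding squarefree_harm_def by (intro sum_mono2) auto

lemma squarefree_harm_diff_le:
  assumes "m \<le> n"
  shows "squarefree_harm n - squarefree_harm m \<le> (\<Sum>j\<in>{m<..n}. 1 / real j)"
proof -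
  have "{j\<in>{1..n}. squarefree j} = {j\<in>{1..m}. squarefree j} \<union> {j\<in>{m<..n}. squarefree j}"
    using assms by auto
  then have "squarefree_harm n = squarefree_harm m + (\<Sum>j\<in>{j\<in>{m<..n}. squarefree j}. 1 / real j)"
    unfolding squarefree_harm_def by (simp only:) (subst sum.union_disjoint; auto)
  moreover have "(\<Sum>j\<in>{j\<in>{m<..n}. squarefree j}. 1 / real j) \<le> (\<Sum>j\<in>{m<..n}. 1 / real j)"
    by (intro sum_mono2) auto
  ultimately show ?thesis by simp
qed

text \<open>The reciprocals between \<open>n div k\<^sup>2\<close> and \<open>n\<close> sum to at
  most the logarithm of the ratio of the endpoints. Rounding down the quotient costs at most a
  factor 2, and \<open>ln 2 < 1\<close>; for quotient 0 the bound \<open>1 + ln n\<close> with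
  \<open>n < k\<^sup>2\<close> takes over.\<close>

lemma squarefree_harm_div_square:
  assumes "k \<ge> 1"
  shows "squarefree_harm n - squarefree_harm (n div k\<^sup>2) \<le> 1 + 2 * ln (real k)"
proof (cases "n div k\<^sup>2 = 0")
  case True
  show ?thesis
  proof (cases "n = 0")
    case False
    have "n < k\<^sup>2" using True assms by (simp add: div_eq_0_iff)
    then have "ln (real n) \<le> ln (real (k\<^sup>2))" using False assms by (subst ln_le_cancel_iff) auto
    also have "\<dots> = 2 * ln (real k)" using assms by (simp add: ln_realpow)
    finally show ?thesis
      using squarefree_harm_diff_le[of 0 n] sum_inverse_le_one_plus_ln[of n] True False
      by (simp add: squarefree_harm_0 atLeastSucAtMost_greaterThanAtMost)
  qed (use assms in simp)
next
  case False
  define a where "a = n div k\<^sup>2"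
  have a: "1 \<le> a" "a \<le> n" using False unfolding a_def by (simp, simp add: div_le_dividend)
  have "n < (a + 1) * k\<^sup>2" using assms unfolding a_def
    by (metis Suc_eq_plus1 dividend_less_div_times le_eq_less_or_eq not_one_le_zero power_eq_0_iff gr0I mult_Suc add.commute)
  also have "\<dots> \<le> (2 * a) * k\<^sup>2" using a by (intro mult_right_mono) auto
  finally have "real n \<le> real (2 * a * k\<^sup>2)" by (simp only: of_nat_le_iff less_imp_le)
  then have "real n / real a \<le> 2 * (real k)\<^sup>2" using a by (simp add: field_simps)
  then have "ln (real n / real a) \<le> ln (2 * (real k)\<^sup>2)" using a assms by (subst ln_le_cancel_iff) auto
  also have "\<dots> = ln 2 + 2 * ln (real k)" using assms by (simp add: ln_mult ln_realpow)
  also have "\<dots> \<le> 1 + 2 * ln (real k)" using ln_2_less_1 by simp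
  finally show ?thesis
    using squarefree_harm_diff_le[OF a(2)] sum_inverse_le_ln[OF a] unfolding a_def by linarith
qed

text \<open>The right-hand side is the integral of \<open>ln t / t\<^sup>2\<close> over
  \<open>[n, n + 1]\<close>; the integrand decreases from \<open>sqrt e\<close> on, hence
  \<open>n \<ge> 2\<close>.\<close>

lemma ln_over_square_le:
  assumes "n \<ge> 2"
  shows "ln (real (Suc n)) / (real (Suc n))\<^sup>2
    \<le> (ln (real n) + 1) / real n - (ln (real (Suc n)) + 1) / real (Suc n)"
proof -
  define x where "x = real n"
  define a where "a = ln (x + 1)"
  define d where "d = a - ln x"
  have x2: "x \<ge> 2" using assms by (simp add: x_def)
  have "exp 1 \<le> x + 1" using exp_le x2 by linarith
  then have "a \<ge> 1" unfolding a_def using x2 by (subst ln_ge_iff) auto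
  have "d \<le> (inverse x + inverse (x + 1)) / 2"
    using ln_inverse_approx_le[of x 1] x2 unfolding d_def a_def by simp
  then have "(x + 1)\<^sup>2 * d \<le> (x + 1)\<^sup>2 * ((inverse x + inverse (x + 1)) / 2)"
    using x2 by (intro mult_left_mono) auto
  also have "\<dots> = (x + 1) + (x + 1) / (2 * x)"
  proof -
    have "x \<noteq> 0" "x + 1 \<noteq> 0" using x2 by auto
    then show ?thesis by (simp add: divide_simps) (simp add: algebra_simps power2_eq_square)
  qed
  also have "(x + 1) / (2 * x) \<le> 1" using x2 by simp
  \<comment> \<open>This is the claim with its denominators cleared, by the trapezoidal bound for
    \<open>d\<close> and \<open>a \<ge> 1\<close>.\<close>
  finally have k: "(x + 1)\<^sup>2 * d \<le> (x + 1) + a" using \<open>a \<ge> 1\<close> by simp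
  have "(ln x + 1) / x - (a + 1) / (x + 1) - a / (x + 1)\<^sup>2 = ((x + 1) + a - (x + 1)\<^sup>2 * d) / (x * (x + 1)\<^sup>2)"
  proof -
    have lx: "ln x = a - d" by (simp add: d_def)
    have "x \<noteq> 0" "x + 1 \<noteq> 0" using x2 by auto
    then show ?thesis unfolding lx by (simp add: divide_simps) (simp add: algebra_simps power2_eq_square)
  qed
  also have "\<dots> \<ge> 0" using k x2 by simp
  finally show ?thesis unfolding a_def x_def by (simp add: add.commute)
qed

lemma sum_ln_over_square_le:
  assumes "n \<ge> 2"
  shows "(\<Sum>k\<in>{1..n}. ln (real k) / (real k)\<^sup>2) \<le> 49 / 48 - (ln (real n) + 1) / real n"
  using assms
proof (induction n rule: dec_induct)
  case base
  have "{1..2::nat} = {1, 2}" by auto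
  \<comment> \<open>Here \<open>49 / 48\<close> is fixed: \<open>3 / 4 * ln 2 + 1 / 2\<close> with
    \<open>ln 2 \<le> 25 / 36\<close>.\<close>
  moreover have "ln 2 / 4 \<le> 49 / 48 - (ln 2 + 1) / (2::real)"
    using ln2_le_25_over_36 by (simp add: field_simps)
  ultimately show ?case by simp
next
  case (step n)
  have "{1..Suc n} = insert (Suc n) {1..n}" by auto
  then show ?case using step ln_over_square_le[of n] by simp
qed

section \<open>Inverse squares and rational bounds for pi\<close>

lemma inverse_squares_tendsto: "(\<lambda>n. \<Sum>k\<in>{1..n}. 1 / (real k)\<^sup>2) \<longlonglongrightarrow> pi\<^sup>2 / 6"
proof -
  have "(\<lambda>n. \<Sum>k<n. 1 / (real k + 1)\<^sup>2) \<longlonglongrightarrow> pi\<^sup>2 / 6"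
    using inverse_squares_sums by (simp add: sums_def add.commute)
  moreover have "(\<Sum>k<n. 1 / (real k + 1)\<^sup>2) = (\<Sum>k\<in>{1..n}. 1 / (real k)\<^sup>2)" for n
    by (rule sum.reindex_bij_witness[of _ "\<lambda>k. k - 1" Suc]) (auto simp: add.commute)
  ultimately show ?thesis by simp
qed

lemma inverse_squares_le: "(\<Sum>k\<in>{1..n}. 1 / (real k)\<^sup>2) \<le> pi\<^sup>2 / 6"
  by (rule incseq_le[OF incseq_SucI inverse_squares_tendsto]) simp

text \<open>Five terms of the series are added exactly. The tail is squeezed between the telescoping
  differences of \<open>1 / (n + 1)\<close> and of \<open>1 / (n + 1 / 2)\<close>, which sum to
  \<open>1 / 6\<close> and \<open>2 / 11\<close>.\<close>

lemma pi_squared_bounds: "489 / 50 \<le> pi\<^sup>2" "pi\<^sup>2 \<le> 49363 / 5000"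
proof -
  define s where "s n = (\<Sum>k\<in>{1..n}. 1 / (real k)\<^sup>2)" for n :: nat
  have s_lim: "s \<longlonglongrightarrow> pi\<^sup>2 / 6" unfolding s_def by (rule inverse_squares_tendsto)
  have s_Suc: "s (Suc n) = s n + 1 / (real n + 1)\<^sup>2" for n by (simp add: s_def add.commute)
  have s5: "s 5 = 5269 / 3600" by (simp add: s_def numeral_eq_Suc)
  have bd: "5269 / 3600 + 1 / 6 - 1 / (real n + 1) \<le> s n \<and> s n \<le> 5269 / 3600 + 2 / 11 - 1 / (real n + 1 / 2)"
    if "n \<ge> 5" for n
    using that
  proof (induction n rule: dec_induct)
    case (step n)
    have n: "real n > 0" using step by simp
    have "1 / (real n + 1) - 1 / (real n + 2) \<le> 1 / (real n + 1)\<^sup>2"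
      using n by (simp add: divide_simps) (simp add: algebra_simps power2_eq_square)
    moreover have "1 / (real n + 1)\<^sup>2 \<le> 1 / (real n + 1 / 2) - 1 / (real n + 3 / 2)"
      using n by (simp add: divide_simps) (simp add: algebra_simps power2_eq_square)
    moreover have e: "real (Suc n) + 1 = real n + 2" "real (Suc n) + 1 / 2 = real n + 3 / 2" by simp_all
    ultimately show ?case using step.IH unfolding s_Suc e by linarith
  qed (simp add: s5)
  have lim: "(\<lambda>n. 5269 / 3600 + 1 / 6 - 1 / (real n + 1)) \<longlonglongrightarrow> 5269 / 3600 + 1 / 6 - 0"
    using LIMSEQ_inverse_real_of_nat by (intro tendsto_intros) (simp add: inverse_eq_divide add.commute)
  have "5269 / 3600 + 1 / 6 - 0 \<le> pi\<^sup>2 / 6"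
    using bd by (intro LIMSEQ_le[OF lim s_lim]) blast
  then show "489 / 50 \<le> pi\<^sup>2" by simp
  have "s n \<le> 5269 / 3600 + 2 / 11" if "n \<ge> 5" for n
  proof -
    have "0 \<le> 1 / (real n + 1 / 2)" by simp
    then show ?thesis using bd[OF that] by linarith
  qed
  then have "pi\<^sup>2 / 6 \<le> 5269 / 3600 + 2 / 11"
    by (intro LIMSEQ_le_const2[OF s_lim]) blast
  then show "pi\<^sup>2 \<le> 49363 / 5000" by simp
qed

lemma pi_upper: "pi \<le> 31421 / 10000"
proof (rule power2_le_imp_le)
  show "pi\<^sup>2 \<le> (31421 / 10000)\<^sup>2"
    by (rule order_trans[OF pi_squared_bounds(2)]) (simp add: power2_eq_square)
qed simp

section \<open>Logarithmic growth of the squarefree harmonic sum\<close>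

text \<open>Crude, with 2 in place of \<open>pi\<^sup>2 / 6\<close>: only divergence is wanted, to
  determine the sign of \<open>L\<close>.\<close>

lemma squarefree_harm_lower:
  assumes "n \<ge> 1"
  shows "ln (real n) / 2 \<le> squarefree_harm n"
proof -
  have "ln (real n + 1) \<le> (\<Sum>j\<in>{1..n}. 1 / real j)"
    using harm_ge_ln[of n] by (simp add: harm_def inverse_eq_divide)
  also have "\<dots> \<le> (\<Sum>k\<in>{1..n}. squarefree_harm n / (real k)\<^sup>2)"
    unfolding harm_squarefree_decomp
    by (intro sum_mono divide_right_mono squarefree_harm_mono div_le_dividend) auto
  also have "\<dots> = squarefree_harm n * (\<Sum>k\<in>{1..n}. 1 / (real k)\<^sup>2)"
    by (simp add: sum_distrib_left)
  also have "\<dots> \<le> squarefree_harm n * 2"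
  proof (intro mult_left_mono squarefree_harm_nonneg)
    have "pi\<^sup>2 / 6 \<le> 2" using pi_squared_bounds by simp
    then show "(\<Sum>k\<in>{1..n}. 1 / (real k)\<^sup>2) \<le> 2" using inverse_squares_le[of n] by linarith
  qed
  finally have "ln (real n + 1) \<le> squarefree_harm n * 2" .
  moreover have "ln (real n) \<le> ln (real n + 1)" using assms by simp
  ultimately show ?thesis by linarith
qed

text \<open>In the decomposition of the harmonic sum by \<open>j = k\<^sup>2 m\<close>, each \<open>squarefree_harm (n div k\<^sup>2)\<close> differs from
  \<open>squarefree_harm n\<close> by at most \<open>1 + 2 ln k\<close>, which is summable against \<open>1 / k\<^sup>2\<close>.\<close>

lemma squarefree_harm_upper:
  assumes "n \<ge> 1"
  shows "squarefree_harm n \<le> 6 / pi\<^sup>2 * ln (real n) + 1 + 49 / (4 * pi\<^sup>2)"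
proof -
  define z where "z K = (\<Sum>k\<in>{1..K}. 1 / (real k)\<^sup>2)" for K :: nat
  \<comment> \<open>The cutoff \<open>K\<close> is independent of \<open>n\<close> so that it can
    tend to infinity, turning \<open>z K\<close> into \<open>pi\<^sup>2 / 6\<close>.\<close>
  have main: "z K * squarefree_harm n \<le> ln (real n) + z K + 49 / 24" if K: "K \<ge> 2" "K \<ge> n" for K
  proof -
    have one: "squarefree_harm n / (real k)\<^sup>2 \<le> squarefree_harm (n div k\<^sup>2) / (real k)\<^sup>2
        + 1 / (real k)\<^sup>2 + 2 * (ln (real k) / (real k)\<^sup>2)" if "k \<ge> 1" for k
    proof -
      have "squarefree_harm n / (real k)\<^sup>2 \<le> (squarefree_harm (n div k\<^sup>2) + 1 + 2 * ln (real k)) / (real k)\<^sup>2"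
        using squarefree_harm_div_square[OF that, of n] by (intro divide_right_mono) auto
      then show ?thesis by (simp add: add_divide_distrib)
    qed
    \<comment> \<open>The term \<open>k = 1\<close> carries no error. Splitting it off replaces
      \<open>z K\<close> by \<open>z K - 1\<close> in the error, which absorbs the 1 of
      \<open>1 + ln n\<close>.\<close>
    have ins: "{1..K} = insert 1 {2..K}" using K by auto
    have "z K * squarefree_harm n = (\<Sum>k\<in>{1..K}. squarefree_harm n / (real k)\<^sup>2)"
      by (simp add: z_def sum_distrib_right)
    also have "\<dots> = squarefree_harm n + (\<Sum>k\<in>{2..K}. squarefree_harm n / (real k)\<^sup>2)"
      unfolding ins by simp
    also have "\<dots> \<le> squarefree_harm n + (\<Sum>k\<in>{2..K}. squarefree_harm (n div k\<^sup>2) / (real k)\<^sup>2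
        + 1 / (real k)\<^sup>2 + 2 * (ln (real k) / (real k)\<^sup>2))"
      using one by (intro add_left_mono sum_mono) auto
    also have "\<dots> = (\<Sum>k\<in>{1..K}. squarefree_harm (n div k\<^sup>2) / (real k)\<^sup>2) + (z K - 1)
       + 2 * (\<Sum>k\<in>{1..K}. ln (real k) / (real k)\<^sup>2)"
      unfolding z_def ins by (simp add: sum.distrib sum_distrib_left)
    also have "(\<Sum>k\<in>{1..K}. squarefree_harm (n div k\<^sup>2) / (real k)\<^sup>2)
       = (\<Sum>k\<in>{1..n}. squarefree_harm (n div k\<^sup>2) / (real k)\<^sup>2)"
    proof (rule sum.mono_neutral_right)
      show "\<forall>k\<in>{1..K} - {1..n}. squarefree_harm (n div k\<^sup>2) / (real k)\<^sup>2 = 0"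
      proof
        fix k assume "k \<in> {1..K} - {1..n}"
        then have "n < k" by auto
        also have "k \<le> k\<^sup>2" by (simp add: power2_eq_square)
        finally show "squarefree_harm (n div k\<^sup>2) / (real k)\<^sup>2 = 0" by (simp add: squarefree_harm_0)
      qed
    qed (use K in auto)
    also have "\<dots> \<le> 1 + ln (real n)"
      using sum_inverse_le_one_plus_ln[OF assms] by (simp only: harm_squarefree_decomp)
    also have "(\<Sum>k\<in>{1..K}. ln (real k) / (real k)\<^sup>2) \<le> 49 / 48"
    proof -
      have "0 \<le> (ln (real K) + 1) / real K" using K by simp
      then show ?thesis using sum_ln_over_square_le[OF K(1)] by linarith
    qed
    finally show ?thesis by simp
  qed
  have "pi\<^sup>2 / 6 * squarefree_harm n \<le> ln (real n) + pi\<^sup>2 / 6 + 49 / 24"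
  proof (rule tendsto_le)
    show "(\<lambda>K. ln (real n) + z K + 49 / 24) \<longlonglongrightarrow> ln (real n) + pi\<^sup>2 / 6 + 49 / 24"
      unfolding z_def by (intro tendsto_intros inverse_squares_tendsto)
    show "(\<lambda>K. z K * squarefree_harm n) \<longlonglongrightarrow> pi\<^sup>2 / 6 * squarefree_harm n"
      unfolding z_def by (intro tendsto_intros inverse_squares_tendsto)
    show "\<forall>\<^sub>F K in sequentially. z K * squarefree_harm n \<le> ln (real n) + z K + 49 / 24"
      using eventually_ge_at_top[of "max 2 n"] by eventually_elim (simp add: main)
  qed simp
  then show ?thesis by (simp add: field_simps)
qed

section \<open>Convolution with the squarefree numbers\<close>

lemma sum_inverse_sqrt_le: "(\<Sum>m\<in>{1..n}. 1 / sqrt (real m)) \<le> 2 * sqrt (real n)"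
proof (induction n)
  case (Suc n)
  have "1 \<le> 2 * (sqrt (real n + 1) - sqrt (real n)) * sqrt (real n + 1)"
  proof -
    have "(sqrt (real n + 1) - sqrt (real n))\<^sup>2 \<ge> 0" by simp
    then show ?thesis by (simp add: power2_eq_square algebra_simps)
  qed
  then have "1 / sqrt (real n + 1) \<le> 2 * (sqrt (real n + 1) - sqrt (real n))"
    by (simp add: pos_divide_le_eq)
  moreover have "{1..Suc n} = insert (Suc n) {1..n}" by auto
  ultimately show ?case using Suc by (simp add: add.commute)
qed simp

text \<open>\<open>min (n div m) D\<close> counts the \<open>j \<le> D\<close> with
  \<open>j * m \<le> n\<close>; counting the same pairs by \<open>j\<close> gives
  \<open>n div j\<close> each.\<close>

lemma sum_min_div_le:
  assumes "D \<ge> 1"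
  shows "(\<Sum>m\<in>{1..n}. real (min (n div m) D)) \<le> real n * (1 + ln (real D))"
proof -
  have "(\<Sum>m\<in>{1..n}. real (min (n div m) D)) = (\<Sum>m\<in>{1..n}. \<Sum>j\<in>{1..D}. of_bool (j \<le> n div m))"
  proof (rule sum.cong[OF refl])
    fix m
    have "(\<Sum>j\<in>{1..D}. of_bool (j \<le> n div m) :: real) = (\<Sum>j\<in>{1..min (n div m) D}. 1)"
      by (rule sum.mono_neutral_cong_right) auto
    then show "real (min (n div m) D) = (\<Sum>j\<in>{1..D}. of_bool (j \<le> n div m))" by simp
  qed
  also have "\<dots> = (\<Sum>j\<in>{1..D}. \<Sum>m\<in>{1..n}. of_bool (j \<le> n div m))" by (rule sum.swap)
  also have "\<dots> \<le> (\<Sum>j\<in>{1..D}. real n * (1 / real j))"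
  proof (rule sum_mono)
    fix j assume j: "j \<in> {1..D}"
    have iff: "j \<le> n div m \<longleftrightarrow> m \<le> n div j" if "m \<ge> 1" for m
      using that j by (simp add: less_eq_div_iff_mult_less_eq mult.commute)
    have "(\<Sum>m\<in>{1..n}. of_bool (j \<le> n div m) :: real) = (\<Sum>m\<in>{1..n div j}. 1)"
      using iff div_le_dividend[of n j] by (intro sum.mono_neutral_cong_right) auto
    also have "\<dots> = real (n div j)" by simp
    also have "\<dots> \<le> real n / real j" by (rule of_nat_div_le_of_nat)
    finally show "(\<Sum>m\<in>{1..n}. of_bool (j \<le> n div m)) \<le> real n * (1 / real j)" by simp
  qed
  also have "\<dots> = real n * (\<Sum>j\<in>{1..D}. 1 / real j)" by (simp only: sum_distrib_left)
  also have "\<dots> \<le> real n * (1 + ln (real D))"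
    using sum_inverse_le_one_plus_ln[OF assms] by (intro mult_left_mono) auto
  finally show ?thesis .
qed

lemma squarefree_divisors_prime_power_mult:
  fixes p e :: nat
  assumes "prime p" "\<not> p dvd e" "k > 0"
  defines "S \<equiv> {m. m dvd e \<and> squarefree m}"
  shows "{m. m dvd p ^ k * e \<and> squarefree m} = S \<union> (*) p ` S"
proof (intro equalityI subsetI)
  fix m assume "m \<in> {m. m dvd p ^ k * e \<and> squarefree m}"
  then have m: "m dvd p ^ k * e" "squarefree m" by auto
  show "m \<in> S \<union> (*) p ` S"
  proof (cases "p dvd m")
    case False
    then have "coprime m (p ^ k)" using prime_imp_coprime[OF assms(1), of m] by (simp add: coprime_commute)
    then show ?thesis using m by (simp add: S_def coprime_dvd_mult_right_iff)
  next
    case True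
    then obtain t where t: "m = p * t" by blast
    have "\<not> p dvd t"
    proof
      assume "p dvd t"
      then have "p\<^sup>2 dvd m" by (simp add: t power2_eq_square)
      then have "p dvd 1" by (rule squarefreeD[OF m(2)])
      then show False using assms(1) by simp
    qed
    then have "coprime t (p ^ k)" using prime_imp_coprime[OF assms(1), of t] by (simp add: coprime_commute)
    moreover have "t dvd p ^ k * e" using m(1) t dvd_mult_right by blast
    ultimately have "t dvd e" by (simp add: coprime_dvd_mult_right_iff)
    moreover have "squarefree t" using m(2) squarefree_mono[of t m] t by simp
    ultimately show ?thesis using t by (auto simp: S_def)
  qed
next
  fix m assume m: "m \<in> S \<union> (*) p ` S"
  show "m \<in> {m. m dvd p ^ k * e \<and> squarefree m}"
  proof (cases "m \<in> S")
    case False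
    then obtain t where t: "m = p * t" "t dvd e" "squarefree t" using m by (auto simp: S_def)
    have "coprime p t" using assms(1,2) t(2) dvd_trans by (blast intro: prime_imp_coprime)
    then have "squarefree m" unfolding t using t(3) assms(1) by (simp add: squarefree_mult_coprime squarefree_prime)
    moreover have "m dvd p ^ k * e" unfolding t using t(2) assms(3) by (intro mult_dvd_mono) (auto simp: dvd_power)
    ultimately show ?thesis by simp
  qed (auto simp: S_def)
qed

section \<open>The convolution and its weighted sums\<close>

context antiperiodic_character
begin

lemma chi_power: "p > 0 \<Longrightarrow> chi (p ^ k) = chi p ^ k"
  by (induction k) (simp_all add: chi_mult chi_one[simplified])

text \<open>The coefficients of \<open>L(s, chi) zeta(s) / zeta(2 s)\<close>, whence the factor
  \<open>L(1, chi) / zeta(2)\<close> in the theorem. The name refers to the number of square roots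
  modulo \<open>d\<close>, which this will bound.\<close>

definition root_count :: "nat \<Rightarrow> real" where
  "root_count d = (\<Sum>m\<in>{m. m dvd d \<and> squarefree m}. chi (d div m))"

lemma root_count_1: "root_count 1 = 1"
proof -
  have "{m::nat. m dvd 1 \<and> squarefree m} = {1}" by auto
  then show ?thesis using chi_one by (simp add: root_count_def)
qed

text \<open>The squarefree divisors without \<open>p\<close> contribute \<open>chi p ^ k\<close>,
  those with exactly one \<open>p\<close> contribute \<open>chi p ^ (k - 1)\<close>.\<close>

lemma root_count_prime_power_mult:
  assumes "prime p" "\<not> p dvd e" "k > 0"
  shows "root_count (p ^ k * e) = (chi p ^ k + chi p ^ (k - 1)) * root_count e"
proof -
  define S where "S = {m. m dvd e \<and> squarefree m}"
  have p0: "p > 0" using assms(1) prime_gt_0_nat by blast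
  have e0: "e > 0" using assms(2) by (cases "e = 0") auto
  have fin: "finite S" unfolding S_def by (rule finite_subset[OF _ finite_divisors_nat[OF e0]]) auto
  have disj: "S \<inter> (*) p ` S = {}" using assms(2) by (auto simp: S_def dest: dvd_mult_left)
  have inj: "inj_on ((*) p) S" using p0 by (simp add: inj_on_def)
  have quot: "e div m > 0" if "m \<in> S" for m
    using that e0 by (auto simp: S_def dvd_div_eq_0_iff)
  have a: "chi (p ^ k * e div m) = chi p ^ k * chi (e div m)" if "m \<in> S" for m
  proof -
    have "p ^ k * e div m = p ^ k * (e div m)" using that by (simp add: S_def div_mult_swap)
    then show ?thesis using chi_mult[of "p ^ k" "e div m"] quot[OF that] p0 by (simp add: chi_power)
  qed
  have b: "chi (p ^ k * e div (p * m)) = chi p ^ (k - 1) * chi (e div m)" if "m \<in> S" for m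
  proof -
    have "p ^ k = p * p ^ (k - 1)" using assms(3) by (simp add: power_eq_if)
    then have "p ^ k * e div (p * m) = p ^ (k - 1) * e div m"
      using p0 by (simp add: mult.assoc)
    also have "\<dots> = p ^ (k - 1) * (e div m)" using that by (simp add: S_def div_mult_swap)
    finally show ?thesis using chi_mult[of "p ^ (k - 1)" "e div m"] quot[OF that] p0 by (simp add: chi_power)
  qed
  have "root_count (p ^ k * e) = (\<Sum>m\<in>S. chi (p ^ k * e div m)) + (\<Sum>m\<in>S. chi (p ^ k * e div (p * m)))"
    unfolding root_count_def squarefree_divisors_prime_power_mult[OF assms] S_def[symmetric]
    using fin disj inj by (subst sum.union_disjoint) (simp_all add: sum.reindex)
  also have "\<dots> = (\<Sum>m\<in>S. chi p ^ k * chi (e div m)) + (\<Sum>m\<in>S. chi p ^ (k - 1) * chi (e div m))"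
    using a b by (intro arg_cong2[where f = "(+)"] sum.cong) auto
  finally show ?thesis by (simp add: root_count_def S_def sum_distrib_left distrib_right sum.distrib)
qed

lemma sum_root_count:
  "(\<Sum>d\<in>{1..n}. g d * root_count d)
    = (\<Sum>m\<in>{m\<in>{1..n}. squarefree m}. \<Sum>l\<in>{1..n div m}. g (m * l) * chi l)"
proof -
  let ?S = "\<lambda>d. {m. m dvd d \<and> squarefree m}" and ?M = "{m\<in>{1..n}. squarefree m}"
  have fin: "finite (?S d)" if "d \<in> {1..n}" for d
    using that by (intro finite_subset[OF _ finite_divisors_nat[of d]]) auto
  have "(\<Sum>d\<in>{1..n}. g d * root_count d) = (\<Sum>d\<in>{1..n}. \<Sum>m\<in>?S d. g d * chi (d div m))"
    by (simp add: root_count_def sum_distrib_left)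
  also have "\<dots> = (\<Sum>(d, m)\<in>Sigma {1..n} ?S. g d * chi (d div m))"
    using fin by (intro sum.Sigma) auto
  also have "\<dots> = (\<Sum>(m, l)\<in>Sigma ?M (\<lambda>m. {1..n div m}). g (m * l) * chi l)"
  proof (rule sum.reindex_bij_witness[of _ "\<lambda>(m, l). (m * l, m)" "\<lambda>(d, m). (m, d div m)"])
    fix x assume x: "x \<in> Sigma {1..n} ?S"
    obtain d m where dm: "x = (d, m)" by force
    have h: "1 \<le> d" "d \<le> n" "m dvd d" "squarefree m" using x dm by auto
    then obtain l where l: "d = m * l" by blast
    have ml: "0 < m" "0 < l" using h l by (auto intro: Nat.gr0I)
    show "(case case x of (d, m) \<Rightarrow> (m, d div m) of (m, l) \<Rightarrow> (m * l, m)) = x"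
      using dm l ml by simp
    show "(case x of (d, m) \<Rightarrow> (m, d div m)) \<in> Sigma ?M (\<lambda>m. {1..n div m})"
    proof -
      have "m * 1 \<le> m * l" using ml by (intro mult_left_mono) auto
      then have "m \<le> n" using h l by linarith
      moreover have "l \<le> n div m" using h l ml by (simp add: less_eq_div_iff_mult_less_eq mult.commute)
      ultimately show ?thesis using dm l ml h by auto
    qed
    show "(case case x of (d, m) \<Rightarrow> (m, d div m) of (m, l) \<Rightarrow> g (m * l) * chi l)
        = (case x of (d, m) \<Rightarrow> g d * chi (d div m))" using dm l ml by simp
  next
    fix x assume x: "x \<in> Sigma ?M (\<lambda>m. {1..n div m})"
    obtain m l where ml: "x = (m, l)" by force
    have h: "1 \<le> m" "m \<le> n" "squarefree m" "1 \<le> l" "l \<le> n div m" using x ml by auto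
    show "(case case x of (m, l) \<Rightarrow> (m * l, m) of (d, m) \<Rightarrow> (m, d div m)) = x" using ml h by simp
    have "m * l \<le> n" using h by (simp add: less_eq_div_iff_mult_less_eq mult.commute)
    then show "(case x of (m, l) \<Rightarrow> (m * l, m)) \<in> Sigma {1..n} ?S" using ml h by auto
  qed
  also have "\<dots> = (\<Sum>m\<in>?M. \<Sum>l\<in>{1..n div m}. g (m * l) * chi l)"
    by (rule sum.Sigma[symmetric]) auto
  finally show ?thesis .
qed

lemma char_sum_le_min: "(\<Sum>l\<in>{1..k}. chi l) \<le> real (min k D)"
proof -
  have "(\<Sum>l\<in>{1..k}. chi l) \<le> (\<Sum>l\<in>{1..k}. 1)"
    using abs_chi_le by (intro sum_mono) (smt (verit) of_bool_eq_1_iff of_bool_less_eq_one)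
  moreover have "(\<Sum>l\<in>{1..k}. chi l) \<le> real D"
    using interval_sum_le'[of 0 k] by (simp add: atLeastSucAtMost_greaterThanAtMost)
  ultimately show ?thesis by simp
qed

lemma sum_root_count_le: "(\<Sum>d\<in>{1..n}. root_count d) \<le> real n * (1 + ln (real D))"
proof -
  have "(\<Sum>d\<in>{1..n}. root_count d) = (\<Sum>m\<in>{m\<in>{1..n}. squarefree m}. \<Sum>l\<in>{1..n div m}. chi l)"
    using sum_root_count[of "\<lambda>_. 1" n] by simp
  also have "\<dots> \<le> (\<Sum>m\<in>{m\<in>{1..n}. squarefree m}. real (min (n div m) D))"
    by (intro sum_mono char_sum_le_min)
  also have "\<dots> \<le> (\<Sum>m\<in>{1..n}. real (min (n div m) D))" by (intro sum_mono2) auto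
  also have "\<dots> \<le> real n * (1 + ln (real D))" by (rule sum_min_div_le[OF D_pos])
  finally show ?thesis .
qed

text \<open>The inner sums are \<open>partial_L (n div m) / m\<close>. Replacing them by
  \<open>L / m\<close> costs \<open>sqrt (D / n) / sqrt m\<close> up to the constant; summed over
  \<open>m\<close> this gains \<open>2 * sqrt n\<close>, and \<open>n\<close> cancels.\<close>

lemma sum_root_count_div_le:
  "(\<Sum>d\<in>{1..n}. root_count d / real d) \<le> L * squarefree_harm n + 1051 / 500 * sqrt (real D)"
proof -
  let ?M = "{m\<in>{1..n}. squarefree m}"
  have "(\<Sum>d\<in>{1..n}. root_count d / real d) = (\<Sum>m\<in>?M. \<Sum>l\<in>{1..n div m}. 1 / real (m * l) * chi l)"
    using sum_root_count[of "\<lambda>d. 1 / real d" n] by simp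
  also have "\<dots> = (\<Sum>m\<in>?M. 1 / real m * partial_L (n div m))"
    unfolding partial_L_def sum_distrib_left by (intro sum.cong refl) simp
  also have "\<dots> \<le> (\<Sum>m\<in>?M. L * (1 / real m) + 1051 / 1000 * sqrt (real D / real n) * (1 / sqrt (real m)))"
  proof (rule sum_mono)
    fix m assume m: "m \<in> ?M"
    then have m': "0 < m" "m \<le> n" by auto
    have k: "1 \<le> n div m" using m' by (simp add: Suc_leI div_greater_zero_iff)
    have "real (n div m) \<le> real n / real m" by (rule of_nat_div_le_of_nat)
    moreover have "real n / real m < real (n div m) + 1"
    proof -
      have "n < (n div m + 1) * m" using dividend_less_div_times[OF m'(1), of n] by (simp add: mult.commute)
      then have "real n < real ((n div m + 1) * m)" by (simp only: of_nat_less_iff)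
      then show ?thesis using m' by (simp add: divide_less_eq distrib_right)
    qed
    ultimately have "\<bar>L - partial_L (n div m)\<bar> \<le> 1051 / 1000 * sqrt (real D / (real n / real m))"
      using k by (intro L_tail_le_sqrt) auto
    also have "sqrt (real D / (real n / real m)) = sqrt (real D / real n) * sqrt (real m)"
      by (simp add: real_sqrt_mult[symmetric])
    finally have "partial_L (n div m) \<le> L + 1051 / 1000 * (sqrt (real D / real n) * sqrt (real m))" by linarith
    then have "1 / real m * partial_L (n div m)
        \<le> 1 / real m * (L + 1051 / 1000 * (sqrt (real D / real n) * sqrt (real m)))"
      by (intro mult_left_mono) auto
    also have "1 / real m * (L + 1051 / 1000 * (sqrt (real D / real n) * sqrt (real m)))
        = L * (1 / real m) + 1051 / 1000 * sqrt (real D / real n) * (sqrt (real m) / real m)"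
      by (simp add: algebra_simps)
    also have "sqrt (real m) / real m = 1 / sqrt (real m)" using m' real_div_sqrt[of "real m"]
      by (simp add: field_simps)
    finally show "1 / real m * partial_L (n div m)
        \<le> L * (1 / real m) + 1051 / 1000 * sqrt (real D / real n) * (1 / sqrt (real m))" .
  qed
  also have "\<dots> = L * squarefree_harm n + 1051 / 1000 * sqrt (real D / real n) * (\<Sum>m\<in>?M. 1 / sqrt (real m))"
    by (simp only: sum.distrib sum_distrib_left squarefree_harm_def)
  also have "\<dots> \<le> L * squarefree_harm n + 1051 / 1000 * sqrt (real D / real n) * (2 * sqrt (real n))"
  proof (intro add_left_mono mult_left_mono)
    have "(\<Sum>m\<in>?M. 1 / sqrt (real m)) \<le> (\<Sum>m\<in>{1..n}. 1 / sqrt (real m))" by (intro sum_mono2) auto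
    then show "(\<Sum>m\<in>?M. 1 / sqrt (real m)) \<le> 2 * sqrt (real n)" using sum_inverse_sqrt_le[of n] by linarith
  qed simp
  also have "\<dots> \<le> L * squarefree_harm n + 1051 / 500 * sqrt (real D)"
    by (cases "n = 0") (simp_all add: real_sqrt_divide)
  finally show ?thesis .
qed

text \<open>Since \<open>squarefree_harm\<close> diverges, a negative \<open>L\<close> would make the left-hand side of
  \<open>sum_root_count_div_le\<close> negative for large \<open>n\<close>.\<close>

lemma L_nonneg:
  assumes "\<And>d. d > 0 \<Longrightarrow> root_count d \<ge> 0"
  shows "L \<ge> 0"
proof (rule ccontr)
  assume "\<not> L \<ge> 0"
  then have neg: "L < 0" by simp
  define C where "C = 1051 / 500 * sqrt (real D)"
  have C0: "C \<ge> 0" by (simp add: C_def)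
  have bound: "- L * ln (real n) \<le> 2 * C" if "n \<ge> 1" for n
  proof -
    have "0 \<le> (\<Sum>d\<in>{1..n}. root_count d / real d)"
      using assms by (intro sum_nonneg divide_nonneg_nonneg) auto
    also have "\<dots> \<le> L * squarefree_harm n + C" unfolding C_def by (rule sum_root_count_div_le)
    also have "L * squarefree_harm n \<le> L * (ln (real n) / 2)"
      using squarefree_harm_lower[OF that] neg by (intro mult_left_mono_neg) auto
    finally show ?thesis by simp
  qed
  \<comment> \<open>The summand 1 forces \<open>- L * ln n \<ge> 2 * C - L\<close>, strictly above
    the bound \<open>2 * C\<close>.\<close>
  obtain n :: nat where n: "exp (2 * C / (- L) + 1) \<le> real n" using real_arch_simple by blast
  have n1: "n \<ge> 1"
  proof (rule ccontr)
    assume "\<not> n \<ge> 1"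
    then have "n = 0" by simp
    then show False using n by (simp add: not_le)
  qed
  have "2 * C / (- L) + 1 \<le> ln (real n)"
    using n n1 by (subst ln_ge_iff) auto
  then have "- L * (2 * C / (- L) + 1) \<le> - L * ln (real n)" using neg by (intro mult_left_mono) auto
  moreover have "- L * (2 * C / (- L) + 1) = 2 * C - L" using neg by (simp add: field_simps)
  ultimately show False using bound[OF n1] neg by linarith
qed

end

section \<open>Square roots modulo d\<close>

definition roots_mod :: "int \<Rightarrow> nat \<Rightarrow> int set" where
  "roots_mod \<delta> d = {x\<in>{0..<int d}. int d dvd x\<^sup>2 - \<delta>}"

lemma finite_roots_mod: "finite (roots_mod \<delta> d)"
  unfolding roots_mod_def by (rule finite_subset[of _ "{0..<int d}"]) auto

lemma dvd_square_diff_cong: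
  fixes x y :: int
  assumes "[x = y] (mod m)" "m dvd x\<^sup>2 - \<delta>"
  shows "m dvd y\<^sup>2 - \<delta>"
proof -
  have "[x\<^sup>2 - \<delta> = y\<^sup>2 - \<delta>] (mod m)" by (intro cong_diff cong_pow assms(1) cong_refl)
  then show ?thesis using assms(2) cong_dvd_iff by blast
qed

text \<open>The injective half of the Chinese remainder theorem; it suffices for an upper
  bound.\<close>

lemma card_roots_mod_mult:
  assumes "coprime a b" "a > 0" "b > 0"
  shows "card (roots_mod \<delta> (a * b)) \<le> card (roots_mod \<delta> a) * card (roots_mod \<delta> b)"
proof -
  let ?h = "\<lambda>x. (x mod int a, x mod int b)"
  have "inj_on ?h (roots_mod \<delta> (a * b))"
  proof (rule inj_onI)
    fix x y assume xy: "x \<in> roots_mod \<delta> (a * b)" "y \<in> roots_mod \<delta> (a * b)" "?h x = ?h y"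
    then have "[x = y] (mod int a)" "[x = y] (mod int b)" by (auto simp: cong_def)
    moreover have "coprime (int a) (int b)" using assms(1) by simp
    ultimately have "[x = y] (mod int a * int b)" by (rule coprime_cong_mult)
    then show "x = y" using xy by (auto simp: roots_mod_def cong_def)
  qed
  moreover have "?h ` roots_mod \<delta> (a * b) \<subseteq> roots_mod \<delta> a \<times> roots_mod \<delta> b"
  proof
    fix z assume "z \<in> ?h ` roots_mod \<delta> (a * b)"
    then obtain x where x: "z = ?h x" "int a * int b dvd x\<^sup>2 - \<delta>" by (auto simp: roots_mod_def)
    have "int a dvd x\<^sup>2 - \<delta>" "int b dvd x\<^sup>2 - \<delta>" using x(2) dvd_mult_left dvd_mult_right by blast+
    then have "int a dvd (x mod int a)\<^sup>2 - \<delta>" "int b dvd (x mod int b)\<^sup>2 - \<delta>"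
      by (auto intro: dvd_square_diff_cong[of x] simp: cong_def)
    then show "z \<in> roots_mod \<delta> a \<times> roots_mod \<delta> b" using x(1) assms by (simp add: roots_mod_def)
  qed
  ultimately have "card (roots_mod \<delta> (a * b)) \<le> card (roots_mod \<delta> a \<times> roots_mod \<delta> b)"
    by (intro card_inj_on_le[of ?h]) (auto intro: finite_roots_mod)
  then show ?thesis by (simp add: card_cartesian_product)
qed

text \<open>Squares are 0 or 1 modulo 4. A root modulo 4 would make \<open>\<delta>\<close>
  congruent to 0, against squarefreeness, or to 1, against the hypothesis.\<close>

lemma card_roots_mod_2:
  assumes "k > 0" "squarefree \<delta>" "\<not> [\<delta> = 1] (mod 4)"
  shows "card (roots_mod \<delta> (2 ^ k)) \<le> (if k = 1 then 1 else 0)"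
proof (cases "k = 1")
  case True
  have "roots_mod \<delta> (2 ^ k) \<subseteq> {\<delta> mod 2}"
  proof
    fix x assume "x \<in> roots_mod \<delta> (2 ^ k)"
    then have x: "x = 0 \<or> x = 1" "even (x\<^sup>2 - \<delta>)" using True by (auto simp: roots_mod_def)
    then show "x \<in> {\<delta> mod 2}" by (auto simp: odd_iff_mod_2_eq_one)
  qed
  then have "card (roots_mod \<delta> (2 ^ k)) \<le> card {\<delta> mod 2}" by (intro card_mono) auto
  then show ?thesis using True by simp
next
  case False
  have "roots_mod \<delta> (2 ^ k) = {}"
  proof (rule ccontr)
    assume "roots_mod \<delta> (2 ^ k) \<noteq> {}"
    then obtain x where "2 ^ k dvd x\<^sup>2 - \<delta>" by (auto simp: roots_mod_def)
    moreover have "(2::int)\<^sup>2 dvd 2 ^ k" using False assms(1) by (intro le_imp_power_dvd) simp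
    ultimately have "(2::int)\<^sup>2 dvd x\<^sup>2 - \<delta>" using dvd_trans by blast
    then have d: "\<delta> mod 4 = x\<^sup>2 mod 4" by (simp add: mod_eq_dvd_iff dvd_diff_commute)
    have "\<not> 2\<^sup>2 dvd \<delta>" using squarefreeD[OF assms(2), of 2] by auto
    then have "\<delta> mod 4 \<noteq> 0" by auto
    moreover have "\<delta> mod 4 \<noteq> 1" using assms(3) by (simp add: cong_def)
    moreover have "x\<^sup>2 mod 4 = 0 \<or> x\<^sup>2 mod 4 = 1"
    proof (cases "even x")
      case True
      then show ?thesis by (auto elim!: evenE simp: power_mult_distrib)
    next
      case False
      then obtain y where "x = 2 * y + 1" by (elim oddE)
      then have "x\<^sup>2 = 1 + 4 * (y\<^sup>2 + y)" by (simp add: power2_eq_square algebra_simps)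
      then have "x\<^sup>2 mod 4 = 1" by presburger
      then show ?thesis by simp
    qed
    ultimately show False using d by simp
  qed
  then show ?thesis by simp
qed

text \<open>\<open>p\<close> divides every root, so a root modulo \<open>p\<^sup>2\<close> would
  give \<open>p\<^sup>2\<close> dividing \<open>\<delta>\<close>.\<close>

lemma card_roots_mod_ramified:
  assumes "prime p" "int p dvd \<delta>" "squarefree \<delta>" "k > 0"
  shows "card (roots_mod \<delta> (p ^ k)) \<le> (if k = 1 then 1 else 0)"
proof -
  have pd: "int p dvd x" if "x \<in> roots_mod \<delta> (p ^ k)" for x
  proof -
    have "int p dvd int p ^ k" using assms(4) by (simp add: dvd_power)
    then have "int p dvd x\<^sup>2 - \<delta>" using that dvd_trans by (auto simp: roots_mod_def)
    then have "int p dvd x\<^sup>2" using assms(2) by (simp add: dvd_diff_left_iff)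
    then show ?thesis using assms(1) prime_dvd_power[of "int p" x 2] by simp
  qed
  show ?thesis
  proof (cases "k = 1")
    case True
    have "roots_mod \<delta> (p ^ k) \<subseteq> {0}"
    proof
      fix x assume x: "x \<in> roots_mod \<delta> (p ^ k)"
      then have "0 \<le> x" "x < int p" using True by (simp_all add: roots_mod_def)
      then show "x \<in> {0}" using zdvd_not_zless[of x "int p"] pd[OF x] by (cases "x = 0") auto
    qed
    then have "card (roots_mod \<delta> (p ^ k)) \<le> card {0::int}" by (intro card_mono) auto
    then show ?thesis using True by simp
  next
    case False
    have "roots_mod \<delta> (p ^ k) = {}"
    proof (rule ccontr)
      assume "roots_mod \<delta> (p ^ k) \<noteq> {}"
      then obtain x where x: "x \<in> roots_mod \<delta> (p ^ k)" by blast
      have "(int p)\<^sup>2 dvd int p ^ k" using False assms(4) by (intro le_imp_power_dvd) simp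
      then have "(int p)\<^sup>2 dvd x\<^sup>2 - \<delta>" using x dvd_trans by (auto simp: roots_mod_def)
      moreover have "(int p)\<^sup>2 dvd x\<^sup>2" using pd[OF x] by simp
      ultimately have "(int p)\<^sup>2 dvd \<delta>" by (simp add: dvd_diff_right_iff)
      then have "int p dvd 1" by (rule squarefreeD[OF assms(3)])
      then show False using assms(1) by auto
    qed
    then show ?thesis by simp
  qed
qed

text \<open>For two roots \<open>p ^ k\<close> divides \<open>(x - y) * (x + y)\<close>. Not both
  factors are divisible by \<open>p\<close>, since \<open>p\<close> does not divide
  \<open>2 * x\<close>, so one of them takes the whole power.\<close>

lemma card_roots_mod_unramified:
  assumes "prime p" "2 < p" "\<not> int p dvd \<delta>"
  shows "card (roots_mod \<delta> (p ^ k)) \<le> 2"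
proof (cases "roots_mod \<delta> (p ^ k) = {} \<or> k = 0")
  case True
  have "roots_mod \<delta> 1 \<subseteq> {0}" by (auto simp: roots_mod_def)
  then have "card (roots_mod \<delta> 1) \<le> card {0::int}" by (intro card_mono) auto
  then show ?thesis using True by auto
next
  case False
  have pp: "prime (int p)" using assms(1) by simp
  from False obtain y where y: "y \<in> roots_mod \<delta> (p ^ k)" by blast
  have pk: "int p dvd int p ^ k" using False by (simp add: dvd_power)
  have "roots_mod \<delta> (p ^ k) \<subseteq> {y, (- y) mod (int p ^ k)}"
  proof
    fix x assume x: "x \<in> roots_mod \<delta> (p ^ k)"
    have "int p ^ k dvd (x\<^sup>2 - \<delta>) - (y\<^sup>2 - \<delta>)"
      by (rule dvd_diff) (use x y in \<open>simp_all add: roots_mod_def\<close>)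
    also have "(x\<^sup>2 - \<delta>) - (y\<^sup>2 - \<delta>) = (x - y) * (x + y)"
      by (simp add: power2_eq_square algebra_simps)
    finally have d: "int p ^ k dvd (x - y) * (x + y)" .
    have py: "\<not> int p dvd x"
    proof
      assume "int p dvd x"
      then have "int p dvd x\<^sup>2" by (simp add: power2_eq_square)
      moreover have "int p dvd x\<^sup>2 - \<delta>" using x pk dvd_trans by (auto simp: roots_mod_def)
      ultimately show False using assms(3) by (simp add: dvd_diff_right_iff)
    qed
    have "\<not> (int p dvd x - y \<and> int p dvd x + y)"
    proof
      assume "int p dvd x - y \<and> int p dvd x + y"
      then have "int p dvd (x - y) + (x + y)" using dvd_add by blast
      then have "int p dvd 2 * x" by simp
      then have "int p dvd 2" using py pp prime_dvd_mult_iff by blast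
      then show False using assms(2) zdvd_imp_le by fastforce
    qed
    then have "coprime (int p ^ k) (x - y) \<or> coprime (int p ^ k) (x + y)"
      using prime_imp_coprime[OF pp] by (auto intro: coprime_power_left_iff[THEN iffD2])
    then have "int p ^ k dvd x + y \<or> int p ^ k dvd x - y"
      using d coprime_dvd_mult_right_iff coprime_dvd_mult_left_iff by blast
    then show "x \<in> {y, (- y) mod (int p ^ k)}"
    proof
      assume "int p ^ k dvd x + y"
      then have "x mod (int p ^ k) = (- y) mod (int p ^ k)" by (simp add: mod_eq_dvd_iff)
      then show ?thesis using x by (auto simp: roots_mod_def)
    next
      assume "int p ^ k dvd x - y"
      then have "x mod (int p ^ k) = y mod (int p ^ k)" by (simp add: mod_eq_dvd_iff)
      then show ?thesis using x y by (auto simp: roots_mod_def)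
    qed
  qed
  then have "card (roots_mod \<delta> (p ^ k)) \<le> card {y, (- y) mod (int p ^ k)}" by (intro card_mono) auto
  also have "\<dots> \<le> 2" by (simp add: card_insert_if)
  finally show ?thesis .
qed

definition kronecker_char :: "int \<Rightarrow> nat \<Rightarrow> real" where
  "kronecker_char \<delta> n = real_of_int (kronecker (4 * \<delta>) (int n))"

lemma kronecker_char_prime:
  assumes "prime p"
  shows "kronecker_char \<delta> p = (if p = 2 then 0 else real_of_int (Legendre \<delta> (int p)))"
proof (cases "p = 2")
  case True
  then show ?thesis by (simp add: kronecker_char_def kronecker_even)
next
  case False
  then have "2 < p" using prime_ge_2_nat[OF assms] by simp
  then show ?thesis using assms False by (simp add: kronecker_char_def kronecker_prime_4)
qed

text \<open>The values 1, -1, 0 of the character give 2, 0 and, by \<open>0 ^ 0 = 1\<close>, the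
  indicator of \<open>k = 1\<close>, matching the three kinds of primes.\<close>

lemma card_roots_mod_prime_power:
  assumes "prime p" "k > 0" "squarefree \<delta>" "\<not> [\<delta> = 1] (mod 4)"
  shows "real (card (roots_mod \<delta> (p ^ k))) \<le> kronecker_char \<delta> p ^ k + kronecker_char \<delta> p ^ (k - 1)"
proof (cases "p = 2 \<or> int p dvd \<delta>")
  case True
  then have "kronecker_char \<delta> p = 0"
    using assms(1) by (auto simp: kronecker_char_prime Legendre_def cong_0_iff)
  moreover have "card (roots_mod \<delta> (p ^ k)) \<le> (if k = 1 then 1 else 0)"
    using True card_roots_mod_2[OF assms(2,3,4)] card_roots_mod_ramified[OF assms(1) _ assms(3,2)] by blast
  ultimately show ?thesis using assms(2) by (cases "k = 1") (auto simp: power_0_left)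
next
  case False
  then have p2: "2 < p" using prime_ge_2_nat[OF assms(1)] by simp
  have ncong: "\<not> [\<delta> = 0] (mod int p)" using False by (simp add: cong_0_iff)
  have c: "kronecker_char \<delta> p = (if QuadRes (int p) \<delta> then 1 else - 1)"
    using False ncong assms(1) by (auto simp: kronecker_char_prime Legendre_def)
  show ?thesis
  proof (cases "QuadRes (int p) \<delta>")
    case True
    then show ?thesis using c card_roots_mod_unramified[OF assms(1) p2, of \<delta> k] False by simp
  next
    case nq: False
    have "roots_mod \<delta> (p ^ k) = {}"
    proof (rule ccontr)
      assume "roots_mod \<delta> (p ^ k) \<noteq> {}"
      then obtain x where x: "int p ^ k dvd x\<^sup>2 - \<delta>" by (auto simp: roots_mod_def)
      moreover have "int p dvd int p ^ k" using assms(2) by (simp add: dvd_power)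
      ultimately have "int p dvd x\<^sup>2 - \<delta>" using dvd_trans by blast
      then show False using nq by (auto simp: QuadRes_def cong_iff_dvd_diff)
    qed
    moreover obtain j where "k = Suc j" using assms(2) gr0_conv_Suc by blast
    ultimately show ?thesis using c nq by simp
  qed
qed

lemma kronecker_char_antiperiodic:
  assumes "squarefree \<delta>" "\<not> [\<delta> = 1] (mod 4)"
  shows "antiperiodic_character (kronecker_char \<delta>) (nat \<bar>\<delta>\<bar>)"
proof
  have d0: "\<delta> \<noteq> 0" using assms(1) by auto
  then show "1 \<le> nat \<bar>\<delta>\<bar>" by simp
  show "kronecker_char \<delta> (m * n) = kronecker_char \<delta> m * kronecker_char \<delta> n" if "0 < m" "0 < n" for m n
    using that kronecker_mult_pos[of "int m" "int n"] by (simp add: kronecker_char_def)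
  show "kronecker_char \<delta> 1 = 1" by (simp add: kronecker_char_def kronecker_one)
  have zero: "kronecker_char \<delta> 0 = 0" using d0 by (simp add: kronecker_char_def kronecker_def)
  show "kronecker_char \<delta> n = 0" if "even n" for n
    using that zero by (cases "n = 0") (auto simp: kronecker_char_def kronecker_even)
  show "kronecker_char \<delta> n \<in> {-1, 0, 1}" for n
  proof (cases "n = 0")
    case False
    then have "\<bar>kronecker (4 * \<delta>) (int n)\<bar> \<le> 1" by (intro abs_kronecker_le) simp
    then have "kronecker (4 * \<delta>) (int n) \<in> {-1, 0, 1}" by auto
    then show ?thesis by (auto simp: kronecker_char_def)
  qed (simp add: zero)
  show "kronecker_char \<delta> (n + 2 * nat \<bar>\<delta>\<bar>) = - kronecker_char \<delta> n" for n
    using kronecker_antiperiodic[OF assms, of "int n"] by (simp add: kronecker_char_def)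
qed

lemma card_roots_mod_le_root_count:
  assumes "squarefree \<delta>" "\<not> [\<delta> = 1] (mod 4)"
  shows "d > 0 \<Longrightarrow> real (card (roots_mod \<delta> d)) \<le> antiperiodic_character.root_count (kronecker_char \<delta>) d"
proof (induction d rule: less_induct)
  case (less d)
  interpret antiperiodic_character "kronecker_char \<delta>" "nat \<bar>\<delta>\<bar>"
    by (rule kronecker_char_antiperiodic[OF assms])
  show ?case
  proof (cases "d = 1")
    case True
    have "roots_mod \<delta> 1 \<subseteq> {0}" by (auto simp: roots_mod_def)
    then have "card (roots_mod \<delta> 1) \<le> card {0::int}" by (intro card_mono) auto
    then show ?thesis using True root_count_1 by simp
  next
    case False
    then obtain p where p: "prime p" "p dvd d" using prime_factor_nat by blast
    define k where "k = multiplicity p d"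
    have k: "k > 0" unfolding k_def using p less.prems
      by (metis multiplicity_eq_zero_iff not_prime_unit gr0I nat_neq_iff)
    obtain e where e: "d = p ^ k * e" "\<not> p dvd e"
      using multiplicity_decompose'[of d p] p less.prems unfolding k_def
      by (metis not_prime_unit gr_implies_not_zero)
    have e0: "e > 0" using e less.prems by (auto intro!: Nat.gr0I)
    have "p ^ k > 1" using one_less_power[OF prime_gt_1_nat[OF p(1)] k] .
    then have "e < d" using e e0 by simp
    then have IH: "real (card (roots_mod \<delta> e)) \<le> root_count e" using less.IH e0 by blast
    have "coprime (p ^ k) e" using prime_imp_coprime[OF p(1) e(2)] by simp
    then have "card (roots_mod \<delta> d) \<le> card (roots_mod \<delta> (p ^ k)) * card (roots_mod \<delta> e)"
      unfolding e(1) using e0 p prime_gt_0_nat by (intro card_roots_mod_mult) auto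
    then have "real (card (roots_mod \<delta> d)) \<le> real (card (roots_mod \<delta> (p ^ k))) * real (card (roots_mod \<delta> e))"
      by (simp only: of_nat_mult[symmetric] of_nat_le_iff)
    also have "\<dots> \<le> (kronecker_char \<delta> p ^ k + kronecker_char \<delta> p ^ (k - 1)) * root_count e"
      using card_roots_mod_prime_power[OF p(1) k assms] IH by (intro mult_mono') auto
    also have "\<dots> = root_count d"
      unfolding e(1) by (rule root_count_prime_power_mult[OF p(1) e(2) k, symmetric])
    finally show ?thesis .
  qed
qed

section \<open>The average number of divisors\<close>

lemma divisor_count_le:
  fixes m :: int and s :: nat
  assumes "m > 0" "m < (int s + 1)\<^sup>2"
  shows "divisor_count m \<le> 2 * card {d\<in>{1..s}. int d dvd m}"
proof -
  let ?A = "{d\<in>{1..s}. int d dvd m}"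
  have "{d::int. d > 0 \<and> d dvd m} \<subseteq> int ` ?A \<union> (\<lambda>d. m div int d) ` ?A"
  proof
    fix d :: int assume "d \<in> {d. d > 0 \<and> d dvd m}"
    then have d: "d > 0" "d dvd m" by auto
    then obtain e where e: "m = d * e" by blast
    have e0: "e > 0" using e d assms(1) zero_less_mult_pos by blast
    show "d \<in> int ` ?A \<union> (\<lambda>d. m div int d) ` ?A"
    proof (cases "d \<le> int s")
      case True
      then have "nat d \<in> ?A" using d by auto
      then show ?thesis using d by force
    next
      case False
      have "e \<le> int s"
      proof (rule ccontr)
        assume "\<not> e \<le> int s"
        then have "(int s + 1) * (int s + 1) \<le> d * e" using False by (intro mult_mono) auto
        then show False using assms(2) e by (simp add: power2_eq_square)
      qed
      then have "nat e \<in> ?A" using e0 e by auto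
      moreover have "d = m div int (nat e)" using e e0 by simp
      ultimately show ?thesis by blast
    qed
  qed
  then have "divisor_count m \<le> card (int ` ?A \<union> (\<lambda>d. m div int d) ` ?A)"
    unfolding divisor_count_def by (intro card_mono) auto
  also have "\<dots> \<le> card (int ` ?A) + card ((\<lambda>d. m div int d) ` ?A)" by (rule card_Un_le)
  also have "\<dots> \<le> card ?A + card ?A" by (intro add_mono card_image_le) auto
  finally show ?thesis by simp
qed

text \<open>\<open>n\<close> is recovered from its block \<open>n div d\<close> and the residue of
  \<open>n + b\<close>, which is a root; there are \<open>N div d + 1\<close> blocks.\<close>

lemma card_dvd_quadratic_le:
  fixes b \<delta> N :: int and d :: nat
  assumes "d > 0" "N \<ge> 0"
  shows "real (card {n\<in>{1..N}. int d dvd (n + b)\<^sup>2 - \<delta>})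
    \<le> (real_of_int N / real d + 1) * real (card (roots_mod \<delta> d))"
proof -
  let ?A = "{n\<in>{1..N}. int d dvd (n + b)\<^sup>2 - \<delta>}"
  let ?h = "\<lambda>n. (n div int d, (n + b) mod int d)"
  have "inj_on ?h ?A"
  proof (rule inj_onI)
    fix x y assume xy: "?h x = ?h y"
    then have "[x + b = y + b] (mod int d)" by (simp add: cong_def)
    then have "[x = y] (mod int d)" by (simp only: cong_add_rcancel)
    then have "x mod int d = y mod int d" by (simp add: cong_def)
    then show "x = y" using xy by (metis Pair_inject div_mult_mod_eq)
  qed
  moreover have "?h ` ?A \<subseteq> {0..N div int d} \<times> roots_mod \<delta> d"
  proof
    fix z assume "z \<in> ?h ` ?A"
    then obtain n where n: "z = ?h n" "1 \<le> n" "n \<le> N" "int d dvd (n + b)\<^sup>2 - \<delta>" by auto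
    have "int d dvd ((n + b) mod int d)\<^sup>2 - \<delta>"
      by (rule dvd_square_diff_cong[OF _ n(4)]) (simp add: cong_def)
    then show "z \<in> {0..N div int d} \<times> roots_mod \<delta> d"
      using n assms by (auto simp: roots_mod_def pos_imp_zdiv_nonneg_iff zdiv_mono1)
  qed
  ultimately have "card ?A \<le> card ({0..N div int d} \<times> roots_mod \<delta> d)"
    by (intro card_inj_on_le[of ?h]) (auto intro: finite_roots_mod)
  then have "real (card ?A) \<le> real (nat (N div int d + 1)) * real (card (roots_mod \<delta> d))"
    by (simp add: card_cartesian_product add.commute flip: of_nat_mult)
  also have "\<dots> \<le> (real_of_int N / real d + 1) * real (card (roots_mod \<delta> d))"
  proof (intro mult_right_mono)
    have "0 \<le> N div int d" using assms by (simp add: pos_imp_zdiv_nonneg_iff)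
    moreover have "real_of_int (N div int d) \<le> real_of_int N / real d"
      using real_of_int_div4[of N "int d"] by simp
    ultimately show "real (nat (N div int d + 1)) \<le> real_of_int N / real d + 1" by simp
  qed simp
  finally show ?thesis .
qed

section \<open>Numerical inequalities for \<open>M\<close> and the endpoint maximum of
  \<open>f\<close>\<close>

lemma riemann_zeta_2: "riemann_zeta 2 = pi\<^sup>2 / 6"
proof -
  have "(\<lambda>n. 1 / real (Suc n) powr 2) sums (pi\<^sup>2 / 6)"
    using inverse_squares_sums by (simp add: add.commute)
  then show ?thesis unfolding riemann_zeta_def by (rule sums_unique[symmetric])
qed

text \<open>The constants for negative \<open>\<delta>\<close> are the smaller ones, as
  \<open>pi < 4\<close>. With \<open>ln 4 \<ge> 4 / 3\<close> and \<open>1 / pi \<ge> 0.318\<close>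
  the coefficient of \<open>s\<close> becomes
  \<open>1.6408 + 0.318 * 4 / 3 = 2.0648\<close>.\<close>

lemma M_const_lower:
  assumes "\<delta> \<noteq> 0"
  defines "s \<equiv> sqrt (real_of_int \<bar>\<delta>\<bar>)" and "l \<equiv> ln (real_of_int \<bar>\<delta>\<bar>)"
  shows "20648 / 10000 * s + 318 / 1000 * (s * l) + 10285 / 10000 \<le> M_const \<delta>"
proof -
  let ?d = "real_of_int \<bar>\<delta>\<bar>"
  have d1: "1 \<le> ?d" using assms(1) by linarith
  have s0: "0 \<le> s" by (simp add: s_def)
  have l0: "0 \<le> l" using d1 by (simp add: l_def)
  have "ln (4::real) = 2 * ln 2" using ln_realpow[of "2::real" 2] by simp
  then have ln4: "4 / 3 + l \<le> ln (4 * ?d)" using d1 ln2_ge_two_thirds by (simp add: ln_mult l_def)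
  have "318 / 1000 \<le> 1 / pi" using pi_upper by (simp add: field_simps)
  then have "318 / 1000 * s * (4 / 3 + l) \<le> 1 / pi * s * ln (4 * ?d)"
    using ln4 s0 l0 by (intro mult_mono) auto
  then have neg: "20648 / 10000 * s + 318 / 1000 * (s * l) + 10285 / 10000
      \<le> 1 / pi * s * ln (4 * ?d) + 16408 / 10000 * s + 10285 / 10000"
    by (simp add: algebra_simps)
  have "1 / pi \<le> 4 / pi\<^sup>2" using pi_less_4 by (simp add: field_simps power2_eq_square)
  then have "1 / pi * s * ln (4 * ?d) \<le> 4 / pi\<^sup>2 * s * ln (4 * ?d)"
    using ln4 s0 l0 by (intro mult_right_mono) auto
  then have "1 / pi * s * ln (4 * ?d) + 16408 / 10000 * s + 10285 / 10000
      \<le> 4 / pi\<^sup>2 * s * ln (4 * ?d) + 18934 / 10000 * s + 1668 / 1000" using s0 by simp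
  with neg show ?thesis by (auto simp: M_const_def Let_def s_def)
qed

text \<open>The difference of the values at \<open>N\<close> and \<open>n\<close> is
  \<open>(N - n) * (N + n + 2 * b)\<close>; the comparison at \<open>n = 1\<close> settles the sign
  of the second factor.\<close>

lemma quadratic_le_endpoint:
  fixes b c n N :: int
  assumes "1 \<le> n" "n \<le> N" "1 + 2 * b + c \<le> N\<^sup>2 + 2 * b * N + c"
  shows "n\<^sup>2 + 2 * b * n + c \<le> N\<^sup>2 + 2 * b * N + c"
proof (cases "n = N")
  case False
  have "0 \<le> (N - 1) * (N + 1 + 2 * b)" using assms(3) by (simp add: power2_eq_square algebra_simps)
  moreover have "N - 1 > 0" using False assms by simp
  ultimately have "0 \<le> N + 1 + 2 * b" by (simp add: zero_le_mult_iff)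
  then have "0 \<le> (N - n) * (N + n + 2 * b)" using assms by (intro mult_nonneg_nonneg) auto
  then show ?thesis by (simp add: power2_eq_square algebra_simps)
qed simp

lemma ln_le_sqrt:
  assumes "x > 0"
  shows "ln x \<le> sqrt x" "ln x \<le> 2 * (sqrt x - 1)"
proof -
  have l: "ln x = 2 * ln (sqrt x)" using assms by (simp add: ln_sqrt)
  have "ln (sqrt x / 2) \<le> sqrt x / 2 - 1" using assms by (intro ln_le_minus_one) simp
  then have "ln (sqrt x) \<le> sqrt x / 2" using ln2_le_25_over_36 assms by (simp add: ln_div)
  then show "ln x \<le> sqrt x" using l by simp
  show "ln x \<le> 2 * (sqrt x - 1)" using l ln_le_minus_one[of "sqrt x"] assms by simp
qed

lemma zeta_2_inverse_bounds: "6077 / 10000 \<le> 6 / pi\<^sup>2" "49 / (4 * pi\<^sup>2) \<le> 12526 / 10000"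
  using pi_squared_bounds by (simp_all add: field_simps)

text \<open>What \<open>M\<close> has to pay for: the factor \<open>1 + l\<close> of
  \<open>sum_root_count_le\<close>, then the surplus over 1.166 times the bound of
  \<open>L_upper\<close> together with the square-root error of
  \<open>sum_root_count_div_le\<close>.\<close>

lemma M_const_bounds:
  assumes "\<delta> \<noteq> 0"
  defines "s \<equiv> sqrt (real_of_int \<bar>\<delta>\<bar>)" and "l \<equiv> ln (real_of_int \<bar>\<delta>\<bar>)"
  shows "0 \<le> M_const \<delta>"
    and "1 + l \<le> 6 / pi\<^sup>2 * M_const \<delta>"
    and "(1 + 49 / (4 * pi\<^sup>2) - 1166 / 1000) * (3 / 2 + l / 2) + 1051 / 500 * s \<le> 12 / pi\<^sup>2 * M_const \<delta>"
proof -
  \<comment> \<open>As an atom, \<open>p\<close> makes both inequalities linear in \<open>s\<close>,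
    \<open>l\<close>, \<open>p\<close>.\<close>
  define p where "p = s * l"
  have d1: "1 \<le> real_of_int \<bar>\<delta>\<bar>" using assms(1) by linarith
  have s1: "1 \<le> s" using d1 by (simp add: s_def)
  have l0: "0 \<le> l" using d1 by (simp add: l_def)
  have p: "l \<le> p" unfolding p_def using mult_right_mono[OF s1 l0] by simp
  have ls: "l \<le> s" "l \<le> 2 * (s - 1)" using ln_le_sqrt[of "real_of_int \<bar>\<delta>\<bar>"] d1 by (simp_all add: s_def l_def)
  have M: "20648 / 10000 * s + 318 / 1000 * p + 10285 / 10000 \<le> M_const \<delta>"
    using M_const_lower[OF assms(1)] by (simp add: s_def l_def p_def)
  then show M0: "0 \<le> M_const \<delta>" using s1 p l0 by simp
  have z: "6077 / 10000 * (20648 / 10000 * s + 318 / 1000 * p + 10285 / 10000) \<le> 6 / pi\<^sup>2 * M_const \<delta>"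
    using zeta_2_inverse_bounds M s1 p l0 by (intro mult_mono) auto
  then show "1 + l \<le> 6 / pi\<^sup>2 * M_const \<delta>" using s1 p ls by simp
  have "(1 + 49 / (4 * pi\<^sup>2) - 1166 / 1000) * (3 / 2 + l / 2) \<le> 10866 / 10000 * (3 / 2 + l / 2)"
    using zeta_2_inverse_bounds l0 by (intro mult_right_mono) auto
  moreover have "10866 / 10000 * (3 / 2 + l / 2) + 1051 / 500 * s
      \<le> 2 * (6077 / 10000 * (20648 / 10000 * s + 318 / 1000 * p + 10285 / 10000))"
    using s1 p ls l0 by (simp add: add_divide_distrib)
  moreover have "12 / pi\<^sup>2 * M_const \<delta> = 2 * (6 / pi\<^sup>2 * M_const \<delta>)" by simp
  ultimately show "(1 + 49 / (4 * pi\<^sup>2) - 1166 / 1000) * (3 / 2 + l / 2) + 1051 / 500 * s \<le> 12 / pi\<^sup>2 * M_const \<delta>"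
    using z by linarith
qed

theorem theorem2:
  fixes b c \<delta> N :: int and f chi :: "int \<Rightarrow> int" and M X L \<zeta>2 :: real
  assumes f_def: "\<And>n. f n = n\<^sup>2 + 2 * b * n + c"
    and delta_def: "\<delta> = b\<^sup>2 - c"
    and "\<delta> \<noteq> 0"
    and "squarefree \<delta>"
    and "\<not> [\<delta> = 1] (mod 4)"
    and "\<And>n. n \<ge> 1 \<Longrightarrow> f n \<ge> 0"
    and chi_def: "\<And>n. chi n = kronecker (4 * \<delta>) n"
    and M_def: "M = M_const \<delta>"
    and L_def: "L = L_one chi"
    and zeta2_def: "\<zeta>2 = riemann_zeta 2"
    and "N \<ge> 1"
    and "f N \<ge> f 1"
    and X_def: "X = sqrt (real_of_int (f N))"
  shows "real (\<Sum>n = 1..N. divisor_count (f n))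
       \<le> 2 / \<zeta>2 * L * real_of_int N * ln X
         + (2.332 * L + 4 * M / \<zeta>2) * real_of_int N
         + 2 * M / \<zeta>2 * X
         + 4 * sqrt 3 * (1 - 1 / \<zeta>2) * M * (real_of_int N / sqrt X)
         + 2 * sqrt 3 * (1 - 1 / \<zeta>2) * M * sqrt X"
proof -
  interpret K: antiperiodic_character "kronecker_char \<delta>" "nat \<bar>\<delta>\<bar>"
    by (rule kronecker_char_antiperiodic[OF assms(4,5)])
  have LK: "L = K.L"
    unfolding L_def K.L_def L_one_def kronecker_char_def by (simp add: chi_def)
  have rc: "real (card (roots_mod \<delta> d)) \<le> K.root_count d" if "d > 0" for d
    by (rule card_roots_mod_le_root_count[OF assms(4,5) that])
  have L0: "L \<ge> 0" unfolding LK using rc by (intro K.L_nonneg) (meson of_nat_0_le_iff order_trans)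
  have f_alt: "f n = (n + b)\<^sup>2 - \<delta>" for n
    by (simp add: f_def delta_def power2_eq_square algebra_simps)
  \<comment> \<open>A zero would make the squarefree \<open>\<delta>\<close> the square of
    \<open>n + b\<close>, hence 1, which is congruent to 1 modulo 4.\<close>
  have f_pos: "f n > 0" if "n \<ge> 1" for n
  proof -
    have "f n \<noteq> 0"
    proof
      assume "f n = 0"
      then have sq: "\<delta> = (n + b)\<^sup>2" by (simp add: f_alt)
      then have "n + b dvd 1" using squarefreeD[OF assms(4), of "n + b"] by simp
      then have "\<bar>n + b\<bar>\<^sup>2 = 1" by simp
      then have "\<delta> = 1" using sq by simp
      then show False using assms(5) by simp
    qed
    then show ?thesis using assms(6)[OF that] by linarith
  qed
  have f_le: "f n \<le> f N" if "1 \<le> n" "n \<le> N" for n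
    using quadratic_le_endpoint[OF that, of b c] assms(12) by (simp add: f_def)
  have fN1: "1 \<le> real_of_int (f N)" using f_pos[OF assms(11)] by linarith
  then have X1: "1 \<le> X" by (simp add: X_def)
  \<comment> \<open>One cutoff serves all \<open>n \<le> N\<close>, because
    \<open>f n \<le> f N < (s + 1)\<^sup>2\<close>.\<close>
  define s where "s = nat \<lfloor>X\<rfloor>"
  have s1: "1 \<le> s" and sX: "real s \<le> X" and Xs: "X < real s + 1"
    using X1 unfolding s_def by linarith+
  have fNs: "f N < (int s + 1)\<^sup>2"
  proof -
    have "real_of_int (f N) = X\<^sup>2" using fN1 by (simp add: X_def)
    also have "\<dots> < (real s + 1)\<^sup>2" using Xs X1 by (intro power_strict_mono) auto
    also have "\<dots> = real_of_int ((int s + 1)\<^sup>2)" by simp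
    finally show ?thesis by (simp only: of_int_less_iff)
  qed
  have N0: "0 \<le> real_of_int N" using assms(11) by simp
  have "(\<Sum>n = 1..N. divisor_count (f n)) \<le> (\<Sum>n = 1..N. 2 * card {d\<in>{1..s}. int d dvd f n})"
  proof (rule sum_mono)
    fix n assume "n \<in> {1..N}"
    then show "divisor_count (f n) \<le> 2 * card {d\<in>{1..s}. int d dvd f n}"
      using f_pos[of n] f_le[of n] fNs by (intro divisor_count_le) auto
  qed
  also have "\<dots> = 2 * (\<Sum>n = 1..N. \<Sum>d = 1..s. of_bool (int d dvd f n))"
    by (simp add: sum_distrib_left[symmetric] sum.If_cases of_bool_def Int_def)
  also have "(\<Sum>n = 1..N. \<Sum>d = 1..s. of_bool (int d dvd f n))
      = (\<Sum>d = 1..s. \<Sum>n = 1..N. of_bool (int d dvd f n) :: nat)" by (rule sum.swap)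
  also have "\<dots> = (\<Sum>d = 1..s. card {n\<in>{1..N}. int d dvd f n})"
    by (simp add: sum.If_cases of_bool_def Int_def)
  finally have "real (\<Sum>n = 1..N. divisor_count (f n))
      \<le> real (2 * (\<Sum>d = 1..s. card {n\<in>{1..N}. int d dvd f n}))" by (simp only: of_nat_le_iff)
  also have "\<dots> = 2 * (\<Sum>d = 1..s. real (card {n\<in>{1..N}. int d dvd f n}))" by simp
  also have "\<dots> \<le> 2 * (\<Sum>d = 1..s. (real_of_int N / real d + 1) * K.root_count d)"
  proof (intro mult_left_mono sum_mono)
    fix d assume d: "d \<in> {1..s}"
    have "real (card {n\<in>{1..N}. int d dvd f n}) \<le> (real_of_int N / real d + 1) * real (card (roots_mod \<delta> d))"
      unfolding f_alt using d assms(11) by (intro card_dvd_quadratic_le) auto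
    also have "\<dots> \<le> (real_of_int N / real d + 1) * K.root_count d"
      using rc[of d] d N0 by (intro mult_left_mono) auto
    finally show "real (card {n\<in>{1..N}. int d dvd f n}) \<le> (real_of_int N / real d + 1) * K.root_count d" .
  qed simp
  also have "\<dots> = 2 * (real_of_int N * (\<Sum>d = 1..s. K.root_count d / real d) + (\<Sum>d = 1..s. K.root_count d))"
    by (simp add: sum_distrib_left distrib_right sum.distrib)
  finally have T: "real (\<Sum>n = 1..N. divisor_count (f n))
      \<le> 2 * (real_of_int N * (\<Sum>d = 1..s. K.root_count d / real d) + (\<Sum>d = 1..s. K.root_count d))" .

  define lD where "lD = ln (real_of_int \<bar>\<delta>\<bar>)"
  define sD where "sD = sqrt (real_of_int \<bar>\<delta>\<bar>)"
  define z where "z = 6 / pi\<^sup>2"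
  have z_eq: "1 / \<zeta>2 = z" unfolding zeta2_def riemann_zeta_2 z_def by simp
  have D_real: "real (nat \<bar>\<delta>\<bar>) = real_of_int \<bar>\<delta>\<bar>" by simp
  note Mb = M_const_bounds[OF assms(3), folded M_def lD_def sD_def]
  have A: "(\<Sum>d = 1..s. K.root_count d) \<le> z * M * X"
  proof -
    have "(\<Sum>d = 1..s. K.root_count d) \<le> real s * (1 + lD)"
      using K.sum_root_count_le[of s] unfolding D_real lD_def .
    also have "\<dots> \<le> X * (z * M)"
    proof (intro mult_mono sX)
      show "1 + lD \<le> z * M" using Mb(2) by (simp add: z_def)
      have "1 \<le> real_of_int \<bar>\<delta>\<bar>" using assms(3) by linarith
      then show "0 \<le> 1 + lD" by (simp add: lD_def)
    qed (use X1 in auto)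
    finally show ?thesis by (simp add: mult_ac)
  qed
  have B: "(\<Sum>d = 1..s. K.root_count d / real d) \<le> z * L * ln X + 1166 / 1000 * L + 2 * z * M"
  proof -
    have "(\<Sum>d = 1..s. K.root_count d / real d) \<le> L * squarefree_harm s + 1051 / 500 * sD"
      using K.sum_root_count_div_le[of s] unfolding D_real sD_def LK .
    also have "L * squarefree_harm s \<le> L * (z * ln X + 1 + 49 / (4 * pi\<^sup>2))"
    proof (intro mult_left_mono L0)
      have "ln (real s) \<le> ln X" using s1 sX by (subst ln_le_cancel_iff) auto
      then have "z * ln (real s) \<le> z * ln X" unfolding z_def by (intro mult_left_mono) auto
      then show "squarefree_harm s \<le> z * ln X + 1 + 49 / (4 * pi\<^sup>2)"
        using squarefree_harm_upper[OF s1] unfolding z_def by linarith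
    qed
    \<comment> \<open>Exactly the permitted \<open>1.166 L\<close> is kept; the rest goes to
      \<open>M\<close> through \<open>L_upper\<close>.\<close>
    also have "\<dots> = z * L * ln X + 1166 / 1000 * L + (1 + 49 / (4 * pi\<^sup>2) - 1166 / 1000) * L"
      by (simp add: algebra_simps)
    also have "(1 + 49 / (4 * pi\<^sup>2) - 1166 / 1000) * L \<le> (1 + 49 / (4 * pi\<^sup>2) - 1166 / 1000) * (3 / 2 + lD / 2)"
    proof (rule mult_left_mono)
      show "L \<le> 3 / 2 + lD / 2" using K.L_upper unfolding D_real LK lD_def by simp
      have "1 \<le> 49 / (4 * pi\<^sup>2)" using pi_squared_bounds by (simp add: field_simps)
      then show "0 \<le> 1 + 49 / (4 * pi\<^sup>2) - 1166 / 1000" by linarith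
    qed
    finally have "(\<Sum>d = 1..s. K.root_count d / real d) \<le> z * L * ln X + 1166 / 1000 * L
        + ((1 + 49 / (4 * pi\<^sup>2) - 1166 / 1000) * (3 / 2 + lD / 2) + 1051 / 500 * sD)" by simp
    also have "\<dots> \<le> z * L * ln X + 1166 / 1000 * L + 12 / pi\<^sup>2 * M" using Mb(3) by simp
    finally show ?thesis by (simp add: z_def)
  qed
  have z1: "z \<le> 1" unfolding z_def using pi_squared_bounds by (simp add: field_simps)
  \<comment> \<open>Since \<open>z \<le> 1\<close>, these two summands of the claim only enlarge a
    bound that already holds.\<close>
  have extra: "0 \<le> 4 * sqrt 3 * (1 - z) * M * (real_of_int N / sqrt X)" "0 \<le> 2 * sqrt 3 * (1 - z) * M * sqrt X"
    using z1 Mb(1) N0 X1 by simp_all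
  have "real (\<Sum>n = 1..N. divisor_count (f n))
      \<le> 2 * (real_of_int N * (z * L * ln X + 1166 / 1000 * L + 2 * z * M) + z * M * X)"
    by (rule order_trans[OF T mult_left_mono[OF add_mono[OF mult_left_mono[OF B N0] A]]]) simp
  also have "\<dots> = 2 * z * L * real_of_int N * ln X + (2.332 * L + 4 * M * z) * real_of_int N + 2 * M * z * X"
    by (simp add: algebra_simps)
  also have "\<dots> \<le> 2 * z * L * real_of_int N * ln X + (2.332 * L + 4 * M * z) * real_of_int N + 2 * M * z * X
      + 4 * sqrt 3 * (1 - z) * M * (real_of_int N / sqrt X) + 2 * sqrt 3 * (1 - z) * M * sqrt X"
    using extra by linarith
  finally show ?thesis by (simp add: z_eq[symmetric])
qed

end
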